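(* Let $\mathcal{L}$ be a language of binding logic and let $\Gamma \vdash \Delta$ be a sequent of closed propositions of $\mathcal{L}$. Then $\Gamma \vdash \Delta$ is provable in the sequent calculus of binding logic if and only if for every binding model $\mathcal{M}$ of $\mathcal{L}$ in which all propositions of $\Gamma$ are valid, there is a proposition of $\Delta$ that is valid in $\mathcal{M}$.
   Context: Binding logic. A language is a set of function symbols and predicate symbols, each with a binding arity, a finite sequence $\langle k_1,\ldots,k_n\rangle$ of natural numbers. Terms: variables are terms; if $f$ is a function symbol of binding arity $\langle k_1,\ldots,k_n\rangle$, $t_1,\ldots,t_n$ are terms and $x^1_1,\ldots,x^1_{k_1},\ldots,x^n_1,\ldots,x^n_{k_n}$ are distinct variables, then $f(x^1_1\cdots x^1_{k_1}\,t_1,\ldots,x^n_1\cdots x^n_{k_n}\,t_n)$ is a term, in which $x^i_1,\ldots,x^i_{k_i}$ are bound in $t_i$. Atomic propositions $P(x^1_1\cdots x^1_{k_1}\,t_1,\ldots)$ are formed similarly from predicate symbols; propositions are closed under $\Rightarrow,\wedge,\vee,\bot,\forall x,\exists x$. Terms and propositions are taken up to $\alpha$-equivalence (renaming of variables bound by quantifiers or by function/predicate symbols), and $(t/x)A$ denotes capture-avoiding substitution, avoiding capture both by quantifiers and by variables bound by function and predicate symbols. Sequents are pairs of multisets of propositions; the sequent calculus of binding logic consists of the usual rules of classical sequent calculus LK (axiom $A\vdash A$, cut, contraction and weakening on both sides, left and right rules for $\Rightarrow,\wedge,\vee$, $\bot$-left, and the quantifier rules $\forall$-left/$\exists$-right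 with an arbitrary term $t$ substituted as $(t/x)A$, $\forall$-right/$\exists$-left with the eigenvariable condition $x\notin FV(\Gamma\Delta)$), with this substitution. Intensional functional structure: sets $M_0,M_1,M_2,\ldots$ with, for each $n$, elements $\mathbf{1}_n,\ldots,\mathbf{n}_n\in M_n$ and, for each $n,p$, a function $\Box_{p,n}: M_n\times M_p^n\to M_p$ such that $\mathbf{i}_n\Box_{p,n}\langle a_1,\ldots,a_n\rangle=a_i$, $a\Box_{n,n}\langle\mathbf{1}_n,\ldots,\mathbf{n}_n\rangle=a$, and $(a\Box_{p,n}\langle b_1,\ldots,b_n\rangle)\Box_{q,p}\langle c_1,\ldots,c_p\rangle = a\Box_{q,n}\langle b_1\Box_{q,p}\langle c_1,\ldots,c_p\rangle,\ldots,b_n\Box_{q,p}\langle c_1,\ldots,c_p\rangle\rangle$. Binding model of $\mathcal{L}$: an intensional functional structure together with, for each function symbol $f$ of binding arity $\langle k_1,\ldots,k_n\rangle$, functions $\hat f_p:\prod_{i=1}^n M_{p+k_i}\to M_p$ ($p=0,1,2,\ldots$) such that $\hat f_p(a_1,\ldots,a_n)\Box_{q,p}\langle b_1,\ldots,b_p\rangle=\hat f_q(a_1\Box_{q+k_1,p+k_1}{\Uparrow_{q,k_1,p}}(\langle b_1,\ldots,b_p\rangle),\ldots,a_n\Box_{q+k_n,p+k_n}{\Uparrow_{q,k_n,p}}(\langle b_1,\ldots,b_p\rangle))$, where ${\Uparrow_{q,k,p}}(\langle b_1,\ldots,b_p\rangle)=\langle\mathbf{1}_{q+k},\ldots,\mathbf{k}_{q+k},b_1\Box_{q+k,q}S,\ldots,b_p\Box_{q+k,q}S\rangle$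 with $S=\langle\mathbf{(1+k)}_{q+k},\ldots,\mathbf{(q+k)}_{q+k}\rangle$; and for each predicate symbol $P$ of binding arity $\langle k_1,\ldots,k_n\rangle$ a function $\hat P:\prod_{i=1}^n M_{k_i}\to\{0,1\}$. Denotation: for a list of variables $x_1,\ldots,x_p$ and an assignment $\phi$ of elements of $M_0$ to the other free variables: $[\![x_k]\!]^{x_1,\ldots,x_p}_\phi=\mathbf{k}_p$; $[\![y]\!]^{x_1,\ldots,x_p}_\phi=\phi(y)\Box_{p,0}\langle\rangle$ if $y$ is not among the $x_i$; $[\![f(y^1_1\cdots y^1_{k_1}t_1,\ldots,y^n_1\cdots y^n_{k_n}t_n)]\!]^{x_1,\ldots,x_p}_\phi=\hat f_p([\![t_1]\!]^{y^1_{k_1},\ldots,y^1_1,x_1,\ldots,x_p}_\phi,\ldots,[\![t_n]\!]^{y^n_{k_n},\ldots,y^n_1,x_1,\ldots,x_p}_\phi)$; $[\![P(y^1_1\cdots y^1_{k_1}t_1,\ldots)]\!]_\phi=\hat P([\![t_1]\!]^{y^1_{k_1},\ldots,y^1_1}_\phi,\ldots)$; connectives are interpreted classically and $\forall x$, $\exists x$ range over $M_0$. A proposition is valid in the model if its denotation is $1$.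
   Formalization: Binding models are required to have a non-empty set M_0; with M_0 empty the statement fails, since ∀x P(x) ⊢ ∃x P(x) is provable but not valid in a model with M_0 empty and no function symbols. *)

theory Defs
  imports "HOL-Library.Multiset"
begin

text \<open>Symbols are drawn from types \<open>'f\<close> and \<open>'p\<close>, but a language is given by sets of symbols,
  so that it may be of any cardinality and may lack function symbols or predicate symbols.\<close>

record ('f, 'p) language =
  fun_syms :: "'f set"
  pred_syms :: "'p set"
  fun_arity :: "'f \<Rightarrow> nat list"
  pred_arity :: "'p \<Rightarrow> nat list"

text \<open>Variables are natural numbers. An argument \<open>(ys, t)\<close> of a symbol stands for \<open>t\<close> preceded by
  the variables \<open>ys\<close>, which are bound in \<open>t\<close>.\<close>

datatype 'f tm =
    Var nat
  | Fn 'f "(nat list \<times> 'f tm) list"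

datatype ('f, 'p) fm =
    Atom 'p "(nat list \<times> 'f tm) list"
  | Falsum
  | Imp "('f, 'p) fm" "('f, 'p) fm"
  | Conj "('f, 'p) fm" "('f, 'p) fm"
  | Disj "('f, 'p) fm" "('f, 'p) fm"
  | Forall nat "('f, 'p) fm"
  | Exists nat "('f, 'p) fm"

fun wf_tm :: "('f, 'p) language \<Rightarrow> 'f tm \<Rightarrow> bool" where
  "wf_tm L (Var x) \<longleftrightarrow> True"
| "wf_tm L (Fn f args) \<longleftrightarrow>
     f \<in> fun_syms L \<and> map (\<lambda>(ys, t). length ys) args = fun_arity L f \<and>
     distinct (concat (map (\<lambda>(ys, t). ys) args)) \<and> (\<forall>(ys, t) \<in> set args. wf_tm L t)"

fun wf_fm :: "('f, 'p) language \<Rightarrow> ('f, 'p) fm \<Rightarrow> bool" where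
  "wf_fm L (Atom P args) \<longleftrightarrow>
     P \<in> pred_syms L \<and> map (\<lambda>(ys, t). length ys) args = pred_arity L P \<and>
     distinct (concat (map (\<lambda>(ys, t). ys) args)) \<and> (\<forall>(ys, t) \<in> set args. wf_tm L t)"
| "wf_fm L Falsum \<longleftrightarrow> True"
| "wf_fm L (Imp A B) \<longleftrightarrow> wf_fm L A \<and> wf_fm L B"
| "wf_fm L (Conj A B) \<longleftrightarrow> wf_fm L A \<and> wf_fm L B"
| "wf_fm L (Disj A B) \<longleftrightarrow> wf_fm L A \<and> wf_fm L B"
| "wf_fm L (Forall x A) \<longleftrightarrow> wf_fm L A"
| "wf_fm L (Exists x A) \<longleftrightarrow> wf_fm L A"

fun fv_tm :: "'f tm \<Rightarrow> nat set" where
  "fv_tm (Var x) = {x}"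
| "fv_tm (Fn f args) = (\<Union>(ys, t) \<in> set args. fv_tm t - set ys)"

fun fv_fm :: "('f, 'p) fm \<Rightarrow> nat set" where
  "fv_fm (Atom P args) = (\<Union>(ys, t) \<in> set args. fv_tm t - set ys)"
| "fv_fm Falsum = {}"
| "fv_fm (Imp A B) = fv_fm A \<union> fv_fm B"
| "fv_fm (Conj A B) = fv_fm A \<union> fv_fm B"
| "fv_fm (Disj A B) = fv_fm A \<union> fv_fm B"
| "fv_fm (Forall x A) = fv_fm A - {x}"
| "fv_fm (Exists x A) = fv_fm A - {x}"

text \<open>Two expressions are compared under two lists of the variables bound so far, innermost first:
  occurrences match if they refer to the same binder, or if both are free and equal.\<close>

fun alpha_var :: "nat list \<Rightarrow> nat list \<Rightarrow> nat \<Rightarrow> nat \<Rightarrow> bool" where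
  "alpha_var (x # xs) (y # ys) u v = (if u = x \<or> v = y then u = x \<and> v = y else alpha_var xs ys u v)"
| "alpha_var xs ys u v = (u = v)"

fun alpha_tm :: "nat list \<Rightarrow> nat list \<Rightarrow> 'f tm \<Rightarrow> 'f tm \<Rightarrow> bool" where
  "alpha_tm xs ys (Var u) (Var v) \<longleftrightarrow> alpha_var xs ys u v"
| "alpha_tm xs ys (Fn f as) (Fn g bs) \<longleftrightarrow> f = g \<and>
     list_all2 (\<lambda>(us, s) (vs, t). length us = length vs \<and> alpha_tm (rev us @ xs) (rev vs @ ys) s t) as bs"
| "alpha_tm xs ys _ _ \<longleftrightarrow> False"

fun alpha_fm :: "nat list \<Rightarrow> nat list \<Rightarrow> ('f, 'p) fm \<Rightarrow> ('f, 'p) fm \<Rightarrow> bool" where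
  "alpha_fm xs ys (Atom P as) (Atom Q bs) \<longleftrightarrow> P = Q \<and>
     list_all2 (\<lambda>(us, s) (vs, t). length us = length vs \<and> alpha_tm (rev us @ xs) (rev vs @ ys) s t) as bs"
| "alpha_fm xs ys Falsum Falsum \<longleftrightarrow> True"
| "alpha_fm xs ys (Imp A B) (Imp A' B') \<longleftrightarrow> alpha_fm xs ys A A' \<and> alpha_fm xs ys B B'"
| "alpha_fm xs ys (Conj A B) (Conj A' B') \<longleftrightarrow> alpha_fm xs ys A A' \<and> alpha_fm xs ys B B'"
| "alpha_fm xs ys (Disj A B) (Disj A' B') \<longleftrightarrow> alpha_fm xs ys A A' \<and> alpha_fm xs ys B B'"
| "alpha_fm xs ys (Forall x A) (Forall y B) \<longleftrightarrow> alpha_fm (x # xs) (y # ys) A B"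
| "alpha_fm xs ys (Exists x A) (Exists y B) \<longleftrightarrow> alpha_fm (x # xs) (y # ys) A B"
| "alpha_fm xs ys _ _ \<longleftrightarrow> False"

definition alpha_eq :: "('f, 'p) fm \<Rightarrow> ('f, 'p) fm \<Rightarrow> bool" where
  "alpha_eq A B \<longleftrightarrow> alpha_fm [] [] A B"

text \<open>Simultaneous substitution by structural recursion. On passing a binder, the bound variables
  \<open>y\<close> are renamed to \<open>m + y\<close>, where \<open>m\<close> exceeds every free variable of the substituted terms;
  this avoids capture and keeps distinct bound variables distinct.\<close>

definition upper :: "nat set \<Rightarrow> nat" where
  "upper X = (LEAST m. \<forall>x \<in> X. x < m)"

fun subst_tm :: "(nat \<Rightarrow> 'f tm) \<Rightarrow> 'f tm \<Rightarrow> 'f tm" where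
  "subst_tm \<sigma> (Var x) = \<sigma> x"
| "subst_tm \<sigma> (Fn f args) =
     (let m = upper (\<Union>w \<in> fv_tm (Fn f args). fv_tm (\<sigma> w))
      in Fn f (map (\<lambda>(ys, t). (map ((+) m) ys,
           subst_tm (\<lambda>w. if w \<in> set ys then Var (m + w) else \<sigma> w) t)) args))"

fun subst_fm :: "(nat \<Rightarrow> 'f tm) \<Rightarrow> ('f, 'p) fm \<Rightarrow> ('f, 'p) fm" where
  "subst_fm \<sigma> (Atom P args) =
     (let m = upper (\<Union>w \<in> fv_fm (Atom P args). fv_tm (\<sigma> w))
      in Atom P (map (\<lambda>(ys, t). (map ((+) m) ys,
           subst_tm (\<lambda>w. if w \<in> set ys then Var (m + w) else \<sigma> w) t)) args))"
| "subst_fm \<sigma> Falsum = Falsum"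
| "subst_fm \<sigma> (Imp A B) = Imp (subst_fm \<sigma> A) (subst_fm \<sigma> B)"
| "subst_fm \<sigma> (Conj A B) = Conj (subst_fm \<sigma> A) (subst_fm \<sigma> B)"
| "subst_fm \<sigma> (Disj A B) = Disj (subst_fm \<sigma> A) (subst_fm \<sigma> B)"
| "subst_fm \<sigma> (Forall x A) =
     (let m = upper (\<Union>w \<in> fv_fm (Forall x A). fv_tm (\<sigma> w))
      in Forall (m + x) (subst_fm (\<sigma>(x := Var (m + x))) A))"
| "subst_fm \<sigma> (Exists x A) =
     (let m = upper (\<Union>w \<in> fv_fm (Exists x A). fv_tm (\<sigma> w))
      in Exists (m + x) (subst_fm (\<sigma>(x := Var (m + x))) A))"

definition subst :: "'f tm \<Rightarrow> nat \<Rightarrow> ('f, 'p) fm \<Rightarrow> ('f, 'p) fm" where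
  "subst t x A = subst_fm (Var(x := t)) A"

text \<open>Sequents are pairs of multisets of representatives of alpha-classes; rule \<open>alpha\<close> identifies
  alpha-equivalent sequents. The well-formedness conditions occur exactly where a rule introduces an
  expression that is not already constrained by its premises, so that derivations stay within
  \<open>L\<close>.\<close>

inductive provable :: "('f, 'p) language \<Rightarrow> ('f, 'p) fm multiset \<Rightarrow> ('f, 'p) fm multiset \<Rightarrow> bool"
  for L where
  alpha: "provable L \<Gamma> \<Delta> \<Longrightarrow> rel_mset alpha_eq \<Gamma> \<Gamma>' \<Longrightarrow> rel_mset alpha_eq \<Delta> \<Delta>' \<Longrightarrow>
    \<forall>A \<in># \<Gamma>' + \<Delta>'. wf_fm L A \<Longrightarrow> provable L \<Gamma>' \<Delta>'"
| ax: "wf_fm L A \<Longrightarrow> provable L {#A#} {#A#}"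
| cut: "provable L (add_mset A \<Gamma>) \<Delta> \<Longrightarrow> provable L \<Gamma> (add_mset A \<Delta>) \<Longrightarrow> provable L \<Gamma> \<Delta>"
| contr_left: "provable L (add_mset A (add_mset A \<Gamma>)) \<Delta> \<Longrightarrow> provable L (add_mset A \<Gamma>) \<Delta>"
| contr_right: "provable L \<Gamma> (add_mset A (add_mset A \<Delta>)) \<Longrightarrow> provable L \<Gamma> (add_mset A \<Delta>)"
| weak_left: "provable L \<Gamma> \<Delta> \<Longrightarrow> wf_fm L A \<Longrightarrow> provable L (add_mset A \<Gamma>) \<Delta>"
| weak_right: "provable L \<Gamma> \<Delta> \<Longrightarrow> wf_fm L A \<Longrightarrow> provable L \<Gamma> (add_mset A \<Delta>)"
| imp_left: "provable L \<Gamma> (add_mset A \<Delta>) \<Longrightarrow> provable L (add_mset B \<Gamma>) \<Delta> \<Longrightarrow>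
    provable L (add_mset (Imp A B) \<Gamma>) \<Delta>"
| imp_right: "provable L (add_mset A \<Gamma>) (add_mset B \<Delta>) \<Longrightarrow> provable L \<Gamma> (add_mset (Imp A B) \<Delta>)"
| conj_left: "provable L (add_mset A (add_mset B \<Gamma>)) \<Delta> \<Longrightarrow> provable L (add_mset (Conj A B) \<Gamma>) \<Delta>"
| conj_right: "provable L \<Gamma> (add_mset A \<Delta>) \<Longrightarrow> provable L \<Gamma> (add_mset B \<Delta>) \<Longrightarrow>
    provable L \<Gamma> (add_mset (Conj A B) \<Delta>)"
| disj_left: "provable L (add_mset A \<Gamma>) \<Delta> \<Longrightarrow> provable L (add_mset B \<Gamma>) \<Delta> \<Longrightarrow>
    provable L (add_mset (Disj A B) \<Gamma>) \<Delta>"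
| disj_right: "provable L \<Gamma> (add_mset A (add_mset B \<Delta>)) \<Longrightarrow> provable L \<Gamma> (add_mset (Disj A B) \<Delta>)"
| falsum_left: "\<forall>A \<in># \<Gamma> + \<Delta>. wf_fm L A \<Longrightarrow> provable L (add_mset Falsum \<Gamma>) \<Delta>"
| forall_left: "provable L (add_mset (subst t x A) \<Gamma>) \<Delta> \<Longrightarrow> wf_tm L t \<Longrightarrow> wf_fm L A \<Longrightarrow>
    provable L (add_mset (Forall x A) \<Gamma>) \<Delta>"
| forall_right: "provable L \<Gamma> (add_mset A \<Delta>) \<Longrightarrow> \<forall>B \<in># \<Gamma> + \<Delta>. x \<notin> fv_fm B \<Longrightarrow>
    provable L \<Gamma> (add_mset (Forall x A) \<Delta>)"
| exists_left: "provable L (add_mset A \<Gamma>) \<Delta> \<Longrightarrow> \<forall>B \<in># \<Gamma> + \<Delta>. x \<notin> fv_fm B \<Longrightarrow>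
    provable L (add_mset (Exists x A) \<Gamma>) \<Delta>"
| exists_right: "provable L \<Gamma> (add_mset (subst t x A) \<Delta>) \<Longrightarrow> wf_tm L t \<Longrightarrow> wf_fm L A \<Longrightarrow>
    provable L \<Gamma> (add_mset (Exists x A) \<Delta>)"

text \<open>\<open>proj M n i\<close> is the element i of \<open>M\<^sub>n\<close> (for \<open>1 \<le> i \<le> n\<close>), and \<open>box M p n a bs\<close> is the
  operation \<open>a \<box>\<^bsub>p,n\<^esub> bs\<close>. The sets \<open>M\<^sub>n\<close> all lie in one type \<open>'u\<close>; they need not be disjoint.
  Any infinite \<open>'u\<close> is a large enough universe: a sequent has finitely many symbols, so if it is
  refutable it has a countable countermodel, in which all other function symbols are constant.\<close>

record 'u functional_structure =
  carr :: "nat \<Rightarrow> 'u set"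
  proj :: "nat \<Rightarrow> nat \<Rightarrow> 'u"
  box :: "nat \<Rightarrow> nat \<Rightarrow> 'u \<Rightarrow> 'u list \<Rightarrow> 'u"

definition tuples :: "('u, 'm) functional_structure_scheme \<Rightarrow> nat \<Rightarrow> nat \<Rightarrow> 'u list set" where
  "tuples M p n = {bs. length bs = n \<and> set bs \<subseteq> carr M p}"

locale intensional_functional_structure =
  fixes M :: "('u, 'm) functional_structure_scheme"
  assumes proj_closed: "1 \<le> i \<Longrightarrow> i \<le> n \<Longrightarrow> proj M n i \<in> carr M n"
    and box_closed: "a \<in> carr M n \<Longrightarrow> bs \<in> tuples M p n \<Longrightarrow> box M p n a bs \<in> carr M p"
    and box_proj: "1 \<le> i \<Longrightarrow> i \<le> n \<Longrightarrow> bs \<in> tuples M p n \<Longrightarrow>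
      box M p n (proj M n i) bs = bs ! (i - 1)"
    and box_id: "a \<in> carr M n \<Longrightarrow> box M n n a (map (proj M n) [1..<Suc n]) = a"
    and box_assoc: "a \<in> carr M n \<Longrightarrow> bs \<in> tuples M p n \<Longrightarrow> cs \<in> tuples M q p \<Longrightarrow>
      box M q p (box M p n a bs) cs = box M q n a (map (\<lambda>b. box M q p b cs) bs)"

record ('f, 'p, 'u) binding_structure = "'u functional_structure" +
  fun_interp :: "'f \<Rightarrow> nat \<Rightarrow> 'u list \<Rightarrow> 'u"
  pred_interp :: "'p \<Rightarrow> 'u list \<Rightarrow> bool"

definition lift :: "('u, 'm) functional_structure_scheme \<Rightarrow> nat \<Rightarrow> nat \<Rightarrow> 'u list \<Rightarrow> 'u list" where
  "lift M q k bs = map (proj M (q + k)) [1..<Suc k] @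
     map (\<lambda>b. box M (q + k) q b (map (proj M (q + k)) [1 + k..<Suc (q + k)])) bs"

text \<open>As usual for classical logic, the domain \<open>M\<^sub>0\<close> of the quantifiers is required to be non-empty.\<close>

locale binding_model = intensional_functional_structure M
  for L :: "('f, 'p) language" and M :: "('f, 'p, 'u) binding_structure" +
  assumes carr_nonempty: "carr M 0 \<noteq> {}"
    and fun_closed: "f \<in> fun_syms L \<Longrightarrow> list_all2 (\<lambda>k a. a \<in> carr M (p + k)) (fun_arity L f) as \<Longrightarrow>
      fun_interp M f p as \<in> carr M p"
    and fun_box: "f \<in> fun_syms L \<Longrightarrow> list_all2 (\<lambda>k a. a \<in> carr M (p + k)) (fun_arity L f) as \<Longrightarrow>
      bs \<in> tuples M q p \<Longrightarrow>
      box M q p (fun_interp M f p as) bs =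
        fun_interp M f q
          (map2 (\<lambda>k a. box M (q + k) (p + k) a (lift M q k bs)) (fun_arity L f) as)"

text \<open>If a variable is repeated in \<open>xs\<close>, its first occurrence counts, as it is the innermost
  binder.\<close>

fun den :: "('f, 'p, 'u) binding_structure \<Rightarrow> nat list \<Rightarrow> (nat \<Rightarrow> 'u) \<Rightarrow> 'f tm \<Rightarrow> 'u" where
  "den M xs \<phi> (Var y) =
     (if y \<in> set xs then proj M (length xs) (Suc (length (takeWhile (\<lambda>x. x \<noteq> y) xs)))
      else box M (length xs) 0 (\<phi> y) [])"
| "den M xs \<phi> (Fn f args) =
     fun_interp M f (length xs) (map (\<lambda>(ys, t). den M (rev ys @ xs) \<phi> t) args)"

fun sat :: "('f, 'p, 'u) binding_structure \<Rightarrow> (nat \<Rightarrow> 'u) \<Rightarrow> ('f, 'p) fm \<Rightarrow> bool" where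
  "sat M \<phi> (Atom P args) \<longleftrightarrow> pred_interp M P (map (\<lambda>(ys, t). den M (rev ys) \<phi> t) args)"
| "sat M \<phi> Falsum \<longleftrightarrow> False"
| "sat M \<phi> (Imp A B) \<longleftrightarrow> (sat M \<phi> A \<longrightarrow> sat M \<phi> B)"
| "sat M \<phi> (Conj A B) \<longleftrightarrow> sat M \<phi> A \<and> sat M \<phi> B"
| "sat M \<phi> (Disj A B) \<longleftrightarrow> sat M \<phi> A \<or> sat M \<phi> B"
| "sat M \<phi> (Forall x A) \<longleftrightarrow> (\<forall>a \<in> carr M 0. sat M (\<phi>(x := a)) A)"
| "sat M \<phi> (Exists x A) \<longleftrightarrow> (\<exists>a \<in> carr M 0. sat M (\<phi>(x := a)) A)"

text \<open>The denotation of a closed proposition does not depend on the assignment, and assignments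
  exist because \<open>M\<^sub>0\<close> is non-empty.\<close>

definition valid :: "('f, 'p, 'u) binding_structure \<Rightarrow> ('f, 'p) fm \<Rightarrow> bool" where
  "valid M A \<longleftrightarrow> (\<forall>\<phi>. range \<phi> \<subseteq> carr M 0 \<longrightarrow> sat M \<phi> A)"

end

theory Submission
  imports Defs "HOL-Library.Countable_Set"
begin

text \<open>Soundness is an induction on derivations. It rests on the lemma that substituting \<open>\<sigma>\<close> into a term
  amounts to composing its denotation with the denotations of the \<open>\<sigma> w\<close>; under a binder of length \<open>k\<close>
  the tuple of these denotations becomes its \<open>lift\<close>.

  For completeness, an unprovable sequent is restricted to its own finitely many symbols and extended
  to a maximal consistent pair of sets with Henkin witnesses; as the sequent has finitely many free
  variables, the variables themselves supply the witnesses. The countermodel consists of de Bruijn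
  terms: the elements of \<open>M\<^sub>n\<close> are those with loose indices below \<open>n\<close>, and \<open>\<box>\<close> is simultaneous
  substitution for the indices. Denotation in it is translation to de Bruijn form, so two terms have
  the same denotation only if they are alpha-equivalent, and every element of \<open>M\<^sub>0\<close> is denoted by a
  term; hence the quantifier case of the truth lemma follows from the substitution lemma, applied in
  the term model itself.\<close>

section \<open>Substitution lemma for denotations\<close>

text \<open>Bound names are the main obstacle. \<open>subst_tm\<close> renames every binder it
  passes, so the two sides of a substitution lemma live in contexts with different names; such
  lemmas therefore compare contexts by position only and connect them by a tuple. The truth lemma
  meets the same gap at atoms: \<open>G\<close> holds named propositions, while the carriers hold de
  Bruijn forms, and rule \<open>alpha\<close> bridges the two. Term models of this kind are possible
  because structures are intensional: an element of \<open>M_n\<close> need not be determined by its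
  action on \<open>M_0\<close>, so open terms can be elements as they stand. Only the propositions
  are restricted to the symbols of the sequent. Provability always refers to the full language
  \<open>L\<close>, which avoids a conservativity argument between the two languages; in return the
  term model must interpret all of \<open>L\<close>.\<close>

lemma tm_induct [case_names Var Fn]:
  assumes "\<And>x. P (Var x)"
    and "\<And>f args. (\<And>ys t. (ys, t) \<in> set args \<Longrightarrow> P t) \<Longrightarrow> P (Fn f args)"
  shows "P t"
proof (induction t)
  case (Fn f args)
  show ?case by (rule assms(2)) (use Fn in \<open>fastforce\<close>)
qed (rule assms(1))

lemma finite_fv_tm [simp]: "finite (fv_tm t)"
  by (induction t rule: tm_induct) auto

lemma finite_fv_fm [simp]: "finite (fv_fm A)"
  by (induction A) auto

lemma less_upper:
  assumes "finite X" "x \<in> X"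
  shows "x < upper X"
proof -
  have "\<forall>x\<in>X. x < Suc (Max X)"
    using assms by (auto simp: less_Suc_eq_le)
  then have "\<forall>x\<in>X. x < upper X"
    unfolding upper_def by (rule LeastI)
  then show ?thesis using assms by blast
qed

lemma fresh_variable:
  fixes X :: "nat set"
  assumes "finite X"
  obtains y where "y \<notin> X"
  using assms ex_new_if_finite infinite_UNIV_nat by blast

text \<open>All arguments of a symbol are renamed with the same \<open>m\<close>, and adding
  \<open>m\<close> is injective; so the concatenated binder lists stay distinct and each keeps its
  length.\<close>

lemma wf_subst_tm:
  "wf_tm L t \<Longrightarrow> (\<And>w. w \<in> fv_tm t \<Longrightarrow> wf_tm L (\<sigma> w)) \<Longrightarrow> wf_tm L (subst_tm \<sigma> t)"
proof (induction t arbitrary: \<sigma> rule: tm_induct)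
  case (Fn f args)
  have *: "concat (map (\<lambda>(ys, t). map ((+) m) ys) args) = map ((+) m) (concat (map (\<lambda>(ys, t). ys) args))"
    for m :: nat
    by (induction args) auto
  have "wf_tm L (subst_tm (\<lambda>w. if w \<in> set ys then Var (m + w) else \<sigma> w) t)"
    if "(ys, t) \<in> set args" for ys t and m :: nat
    using that Fn.prems by (intro Fn.IH) (auto split: if_splits)
  then show ?case using Fn.prems
    by (auto simp: Let_def case_prod_unfold distinct_map *[unfolded case_prod_unfold] comp_def)
qed simp

lemma wf_subst_fm:
  "wf_fm L A \<Longrightarrow> (\<And>w. w \<in> fv_fm A \<Longrightarrow> wf_tm L (\<sigma> w)) \<Longrightarrow> wf_fm L (subst_fm \<sigma> A)"
proof (induction A arbitrary: \<sigma>)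
  case (Atom P args)
  have *: "concat (map (\<lambda>(ys, t). map ((+) m) ys) args) = map ((+) m) (concat (map (\<lambda>(ys, t). ys) args))"
    for m :: nat
    by (induction args) auto
  have "wf_tm L (subst_tm (\<lambda>w. if w \<in> set ys then Var (m + w) else \<sigma> w) t)"
    if "(ys, t) \<in> set args" for ys t and m :: nat
    using that Atom.prems by (intro wf_subst_tm) (auto split: if_splits)
  then show ?case using Atom.prems
    by (auto simp: Let_def case_prod_unfold distinct_map *[unfolded case_prod_unfold] comp_def)
qed (auto simp: Let_def)

lemma wf_subst: "wf_fm L A \<Longrightarrow> wf_tm L t \<Longrightarrow> wf_fm L (subst t x A)"
  by (simp add: subst_def wf_subst_fm)

text \<open>Counting starts at 0, whereas \<open>proj\<close> counts from 1, hence the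
  \<open>Suc\<close> in \<open>den_Var\<close>. The same number is the de Bruijn index in
  \<open>db_of\<close> and the position that \<open>alpha_var\<close> compares.\<close>

definition index :: "nat list \<Rightarrow> nat \<Rightarrow> nat" where
  "index xs y = length (takeWhile (\<lambda>x. x \<noteq> y) xs)"

lemma den_Var:
  "den M xs \<phi> (Var y) =
    (if y \<in> set xs then proj M (length xs) (Suc (index xs y)) else box M (length xs) 0 (\<phi> y) [])"
  by (simp add: index_def)

declare den.simps(1) [simp del]

lemma index_less: "y \<in> set xs \<Longrightarrow> index xs y < length xs"
  unfolding index_def by (induction xs) auto

lemma nth_index: "y \<in> set xs \<Longrightarrow> xs ! index xs y = y"
  unfolding index_def by (induction xs) auto

lemma index_nth: "distinct xs \<Longrightarrow> i < length xs \<Longrightarrow> index xs (xs ! i) = i"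
  by (metis index_less nth_eq_iff_index_eq nth_index nth_mem)

lemma index_append:
  "index (us @ xs) y = (if y \<in> set us then index us y else length us + index xs y)"
  unfolding index_def by (induction us) auto

lemma index_map: "inj f \<Longrightarrow> index (map f xs) (f y) = index xs y"
  unfolding index_def by (induction xs) (auto dest: injD)

text \<open>The tuple \<open>S\<close> of the binding-model equation. It moves an element of
  \<open>M_p\<close> into a context with \<open>k\<close> further innermost variables; these take
  positions 1 to \<open>k\<close>, so the old ones start at \<open>1 + k\<close>.\<close>

definition shift :: "('u, 'm) functional_structure_scheme \<Rightarrow> nat \<Rightarrow> nat \<Rightarrow> 'u list" where
  "shift M p k = map (proj M (p + k)) [1 + k..<Suc (p + k)]"

lemma lift_conv_shift:
  "lift M q k bs = map (proj M (q + k)) [1..<Suc k] @ map (\<lambda>b. box M (q + k) q b (shift M q k)) bs"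
  by (simp add: lift_def shift_def)

section \<open>Shifting and lifting in a functional structure\<close>

context intensional_functional_structure
begin

lemma Nil_tuple [simp]: "[] \<in> tuples M p 0"
  by (simp add: tuples_def)

lemma shift_tuple: "shift M p k \<in> tuples M (p + k) p"
  by (auto simp: tuples_def shift_def intro!: proj_closed)

lemma lift_tuple:
  assumes "bs \<in> tuples M q p"
  shows "lift M q k bs \<in> tuples M (q + k) (p + k)"
  using assms box_closed[OF _ shift_tuple]
  by (auto simp: tuples_def lift_conv_shift subset_iff intro!: proj_closed)

text \<open>Associativity turns both sides into \<open>a\<close> composed with a tuple, and the
  tuples agree entrywise. This exchange lets a hypothesis on free variables pass a binder.\<close>

lemma box_lift_shift:
  assumes bs: "bs \<in> tuples M q p" and a: "a \<in> carr M p"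
  shows "box M (q + k) (p + k) (box M (p + k) p a (shift M p k)) (lift M q k bs) =
    box M (q + k) q (box M q p a bs) (shift M q k)"
proof -
  have "map (\<lambda>b. box M (q + k) (p + k) b (lift M q k bs)) (shift M p k) =
    map (\<lambda>b. box M (q + k) q b (shift M q k)) bs"
  proof (rule nth_equalityI)
    show "length (map (\<lambda>b. box M (q + k) (p + k) b (lift M q k bs)) (shift M p k)) =
      length (map (\<lambda>b. box M (q + k) q b (shift M q k)) bs)"
      using bs by (simp add: shift_def tuples_def)
  next
    fix i assume "i < length (map (\<lambda>b. box M (q + k) (p + k) b (lift M q k bs)) (shift M p k))"
    then have i: "i < p" by (simp add: shift_def del: upt_Suc)
    \<comment> \<open>Entry \<open>i\<close> of \<open>shift\<close> skips the \<open>k\<close>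
      projections that open \<open>lift\<close> and so selects entry \<open>i\<close> of its second
      block.\<close>
    have "shift M p k ! i = proj M (p + k) (Suc (k + i))"
      using i by (simp add: shift_def del: upt_Suc)
    moreover have "box M (q + k) (p + k) (proj M (p + k) (Suc (k + i))) (lift M q k bs) =
        lift M q k bs ! (k + i)"
      using i by (subst box_proj[OF _ _ lift_tuple[OF bs]]) auto
    ultimately show "map (\<lambda>b. box M (q + k) (p + k) b (lift M q k bs)) (shift M p k) ! i =
      map (\<lambda>b. box M (q + k) q b (shift M q k)) bs ! i"
      using i bs by (simp add: shift_def lift_conv_shift nth_append tuples_def del: upt_Suc)
  qed
  then show ?thesis
    using box_assoc[OF a shift_tuple lift_tuple[OF bs], of k]
      box_assoc[OF a bs shift_tuple, of k] by simp
qed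

end

section \<open>Denotations of terms under substitution\<close>

context binding_model
begin

lemma den_Var_closed:
  assumes "range \<phi> \<subseteq> carr M 0"
  shows "den M xs \<phi> (Var y) \<in> carr M (length xs)"
proof (cases "y \<in> set xs")
  case True
  then show ?thesis using index_less[OF True] by (auto simp: den_Var intro!: proj_closed)
next
  case False
  then show ?thesis using assms by (auto simp: den_Var intro!: box_closed)
qed

lemma den_closed:
  assumes "range \<phi> \<subseteq> carr M 0"
  shows "wf_tm L t \<Longrightarrow> den M xs \<phi> t \<in> carr M (length xs)"
proof (induction t arbitrary: xs rule: tm_induct)
  case (Var x)
  then show ?case using assms by (simp add: den_Var_closed)
next
  case (Fn f args)
  have ar: "fun_arity L f = map (\<lambda>(ys, t). length ys) args" and f: "f \<in> fun_syms L"
    using Fn.prems by auto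
  have "den M (rev ys @ xs) \<phi> t \<in> carr M (length xs + length ys)" if "(ys, t) \<in> set args" for ys t
    using Fn.IH[OF that, of "rev ys @ xs"] Fn.prems that by (auto simp: add.commute)
  then show ?case
    using f by (auto simp: ar list_all2_map1 list_all2_map2 case_prod_unfold
        intro!: fun_closed list_all2_refl list.rel_refl_strong)
qed

lemma den_Var_shift:
  assumes "range \<phi> \<subseteq> carr M 0" "w \<notin> set us"
  shows "den M (us @ xs) \<phi> (Var w) =
    box M (length xs + length us) (length xs) (den M xs \<phi> (Var w)) (shift M (length xs) (length us))"
proof (cases "w \<in> set xs")
  case True
  then show ?thesis using index_less[OF True] assms
    by (simp add: den_Var index_append box_proj[OF _ _ shift_tuple])
      (simp add: shift_def add_ac del: upt_Suc)
next
  case False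
  moreover have "\<phi> w \<in> carr M 0" using assms by auto
  ultimately show ?thesis using assms box_assoc[OF _ Nil_tuple shift_tuple, of "\<phi> w" "length xs" "length us"]
    by (simp add: den_Var add.commute)
qed

text \<open>The axiom \<open>fun_box\<close> with denotations as arguments; both inductions on terms
  below settle their \<open>Fn\<close> case with it.\<close>

lemma box_den_Fn:
  assumes args: "wf_tm L (Fn f args)" and \<psi>: "range \<psi> \<subseteq> carr M 0"
    and bs: "bs \<in> tuples M q (length zs)"
  shows "box M q (length zs) (den M zs \<psi> (Fn f args)) bs =
    fun_interp M f q (map (\<lambda>(ys, t). box M (q + length ys) (length zs + length ys)
      (den M (rev ys @ zs) \<psi> t) (lift M q (length ys) bs)) args)"
proof -
  have ar: "fun_arity L f = map (\<lambda>(ys, t). length ys) args" and f: "f \<in> fun_syms L"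
    using args by auto
  have "den M (rev ys @ zs) \<psi> t \<in> carr M (length zs + length ys)" if "(ys, t) \<in> set args" for ys t
    using den_closed[OF \<psi>, of t "rev ys @ zs"] args that by (auto simp: add.commute)
  then show ?thesis
    using f bs by (subst den.simps, subst fun_box)
      (auto simp: ar list_all2_map1 list_all2_map2 case_prod_unfold zip_map_map zip_same_conv_map comp_def
        intro!: list.rel_refl_strong)
qed

lemma box_den_bound_Var:
  assumes "w \<in> set us" "bs \<in> tuples M q (length zs)"
  shows "box M (q + length us) (length zs + length us) (den M (us @ zs) \<psi> (Var w))
      (lift M q (length us) bs) = proj M (q + length us) (Suc (index us w))"
  using index_less[OF assms(1)] assms(1) box_proj[OF _ _ lift_tuple[OF assms(2)], of "Suc (index us w)" "length us"]
  by (simp add: den_Var index_append add.commute lift_conv_shift nth_append del: upt_Suc)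

text \<open>This is \<open>den_subst_tm\<close> below without the substitution. It is proved separately because it
  gives the weakening of contexts (\<open>den_shift\<close>) that substitution needs on passing a binder.\<close>

lemma den_morphism:
  assumes "range \<phi> \<subseteq> carr M 0" "range \<psi> \<subseteq> carr M 0"
  shows "wf_tm L t \<Longrightarrow> bs \<in> tuples M (length xs) (length zs) \<Longrightarrow>
    (\<And>w. w \<in> fv_tm t \<Longrightarrow>
      den M xs \<phi> (Var w) = box M (length xs) (length zs) (den M zs \<psi> (Var w)) bs) \<Longrightarrow>
    den M xs \<phi> t = box M (length xs) (length zs) (den M zs \<psi> t) bs"
proof (induction t arbitrary: xs zs bs rule: tm_induct)
  case (Var x)
  then show ?case by simp
next
  case (Fn f args)
  have "den M (rev ys @ xs) \<phi> t = box M (length xs + length ys) (length zs + length ys)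
      (den M (rev ys @ zs) \<psi> t) (lift M (length xs) (length ys) bs)"
    if yt: "(ys, t) \<in> set args" for ys t
  proof -
    have "den M (rev ys @ xs) \<phi> t = box M (length (rev ys @ xs)) (length (rev ys @ zs))
      (den M (rev ys @ zs) \<psi> t) (lift M (length xs) (length ys) bs)"
    proof (rule Fn.IH[OF yt])
      show "wf_tm L t" using Fn.prems yt by auto
      show "lift M (length xs) (length ys) bs \<in>
          tuples M (length (rev ys @ xs)) (length (rev ys @ zs))"
        using lift_tuple[OF Fn.prems(2), of "length ys"] by (simp add: add.commute)
      fix w assume w: "w \<in> fv_tm t"
      show "den M (rev ys @ xs) \<phi> (Var w) = box M (length (rev ys @ xs)) (length (rev ys @ zs))
        (den M (rev ys @ zs) \<psi> (Var w)) (lift M (length xs) (length ys) bs)"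
      \<comment> \<open>A bound variable meets the projections at the front of \<open>lift\<close>.
        For any other variable both sides are weakenings past \<open>ys\<close>, and
        \<open>box_lift_shift\<close> reduces them to the hypothesis in the outer contexts.\<close>
      proof (cases "w \<in> set ys")
        case True
        then show ?thesis using box_den_bound_Var[OF _ Fn.prems(2), of w "rev ys"]
          by (simp add: den_Var index_append add.commute)
      next
        case False
        then have "w \<in> fv_tm (Fn f args)" using w yt by auto
        then show ?thesis
          using False den_Var_shift[OF assms(1), of w "rev ys" xs]
            den_Var_shift[OF assms(2), of w "rev ys" zs] Fn.prems
            box_lift_shift[OF Fn.prems(2) den_Var_closed[OF assms(2)], of "length ys" w]
          by (simp add: add.commute)
      qed
    qed
    then show ?thesis by (simp add: add.commute)
  qed
  then show ?case
    unfolding box_den_Fn[OF Fn.prems(1) assms(2) Fn.prems(2)]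
    by (auto intro!: arg_cong[where f = "fun_interp M f (length xs)"])
qed

lemma den_shift:
  assumes "range \<phi> \<subseteq> carr M 0" "wf_tm L t" "set us \<inter> fv_tm t = {}"
  shows "den M (us @ xs) \<phi> t =
    box M (length xs + length us) (length xs) (den M xs \<phi> t) (shift M (length xs) (length us))"
proof -
  have "den M (us @ xs) \<phi> t =
    box M (length (us @ xs)) (length xs) (den M xs \<phi> t) (shift M (length xs) (length us))"
  proof (rule den_morphism[OF assms(1,1,2)])
    show "shift M (length xs) (length us) \<in> tuples M (length (us @ xs)) (length xs)"
      using shift_tuple[of "length xs" "length us"] by (simp add: add.commute)
    fix w assume "w \<in> fv_tm t"
    then have "w \<notin> set us" using assms(3) by blast
    from den_Var_shift[OF assms(1) this, of xs]
    show "den M (us @ xs) \<phi> (Var w) = box M (length (us @ xs)) (length xs) (den M xs \<phi> (Var w))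
      (shift M (length xs) (length us))"
      by (simp add: add.commute)
  qed
  then show ?thesis by (simp add: add.commute)
qed

text \<open>Capture is excluded here: the renamed binders are at least \<open>m\<close>, hence not
  free in any \<open>\<sigma> w\<close>, and \<open>den_shift\<close> can weaken
  \<open>\<sigma> w\<close> past them. Conditions on \<open>\<sigma>\<close> are limited to
  variables outside \<open>ys\<close> because the binder overrides it on the others.\<close>

lemma den_subst_arg:
  assumes \<phi>: "range \<phi> \<subseteq> carr M 0" and \<psi>: "range \<psi> \<subseteq> carr M 0"
    and bs: "bs \<in> tuples M (length xs) (length zs)"
    and m: "\<And>w v. w \<in> fv_tm t - set ys \<Longrightarrow> v \<in> fv_tm (\<sigma> w) \<Longrightarrow> v < m"
    and wf: "\<And>w. w \<in> fv_tm t - set ys \<Longrightarrow> wf_tm L (\<sigma> w)"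
    and \<sigma>: "\<And>w. w \<in> fv_tm t - set ys \<Longrightarrow>
      den M xs \<phi> (\<sigma> w) = box M (length xs) (length zs) (den M zs \<psi> (Var w)) bs"
    and w: "w \<in> fv_tm t"
  shows "den M (rev (map ((+) m) ys) @ xs) \<phi> (if w \<in> set ys then Var (m + w) else \<sigma> w) =
    box M (length xs + length ys) (length zs + length ys)
      (den M (rev ys @ zs) \<psi> (Var w)) (lift M (length xs) (length ys) bs)"
proof (cases "w \<in> set ys")
  case True
  have "index (rev (map ((+) m) ys)) (m + w) = index (rev ys) w"
    using index_map[of "(+) m" "rev ys" w] by (simp add: rev_map)
  then show ?thesis using True box_den_bound_Var[OF _ bs, of w "rev ys"]
    by (auto simp: den_Var index_append add.commute)
next
  case False
  then have "set (rev (map ((+) m) ys)) \<inter> fv_tm (\<sigma> w) = {}"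
    using m[of w] w by fastforce
  from den_shift[OF \<phi> wf this] show ?thesis
    using False den_Var_shift[OF \<psi>, of w "rev ys" zs] \<sigma>[of w] w
      box_lift_shift[OF bs den_Var_closed[OF \<psi>], of "length ys" w]
    by (simp add: add.commute)
qed

text \<open>Under a binder \<open>y\<close> the original term acquires \<open>y\<close> in its
  context and the substituted one \<open>m + y\<close>, so the induction keeps two unrelated
  contexts \<open>xs\<close> and \<open>zs\<close>, with two assignments; the tuple
  \<open>bs\<close> is their only link.\<close>

lemma den_subst_tm:
  assumes "range \<phi> \<subseteq> carr M 0" "range \<psi> \<subseteq> carr M 0"
  shows "wf_tm L t \<Longrightarrow> bs \<in> tuples M (length xs) (length zs) \<Longrightarrow>
    (\<And>w. w \<in> fv_tm t \<Longrightarrow> wf_tm L (\<sigma> w)) \<Longrightarrow>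
    (\<And>w. w \<in> fv_tm t \<Longrightarrow>
      den M xs \<phi> (\<sigma> w) = box M (length xs) (length zs) (den M zs \<psi> (Var w)) bs) \<Longrightarrow>
    den M xs \<phi> (subst_tm \<sigma> t) = box M (length xs) (length zs) (den M zs \<psi> t) bs"
proof (induction t arbitrary: xs zs bs \<sigma> rule: tm_induct)
  case (Var x)
  then show ?case by simp
next
  case (Fn f args)
  define m where "m = upper (\<Union>w \<in> fv_tm (Fn f args). fv_tm (\<sigma> w))"
  have "den M (rev (map ((+) m) ys) @ xs) \<phi>
        (subst_tm (\<lambda>w. if w \<in> set ys then Var (m + w) else \<sigma> w) t) =
      box M (length xs + length ys) (length zs + length ys)
        (den M (rev ys @ zs) \<psi> t) (lift M (length xs) (length ys) bs)"
    if yt: "(ys, t) \<in> set args" for ys t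
  proof -
    have sub: "fv_tm t - set ys \<subseteq> fv_tm (Fn f args)" using yt by auto
    have m: "v < m" if "w \<in> fv_tm t - set ys" "v \<in> fv_tm (\<sigma> w)" for w v
      unfolding m_def using that sub by (intro less_upper) (auto simp del: fv_tm.simps)
    have "den M (rev (map ((+) m) ys) @ xs) \<phi>
        (subst_tm (\<lambda>w. if w \<in> set ys then Var (m + w) else \<sigma> w) t) =
      box M (length (rev (map ((+) m) ys) @ xs)) (length (rev ys @ zs))
        (den M (rev ys @ zs) \<psi> t) (lift M (length xs) (length ys) bs)"
    proof (rule Fn.IH[OF yt])
      show "wf_tm L t" using Fn.prems yt by auto
      show "lift M (length xs) (length ys) bs \<in>
          tuples M (length (rev (map ((+) m) ys) @ xs)) (length (rev ys @ zs))"
        using lift_tuple[OF Fn.prems(2), of "length ys"] by (simp add: add.commute)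
      fix w assume w: "w \<in> fv_tm t"
      show "wf_tm L (if w \<in> set ys then Var (m + w) else \<sigma> w)"
        using w sub Fn.prems(3) by auto
      show "den M (rev (map ((+) m) ys) @ xs) \<phi> (if w \<in> set ys then Var (m + w) else \<sigma> w) =
        box M (length (rev (map ((+) m) ys) @ xs)) (length (rev ys @ zs))
          (den M (rev ys @ zs) \<psi> (Var w)) (lift M (length xs) (length ys) bs)"
        using den_subst_arg[OF assms Fn.prems(2) m _ _ w] Fn.prems(3,4) sub
        by (simp add: subset_iff add.commute)
    qed
    then show ?thesis by (simp add: add.commute)
  qed
  then show ?case unfolding box_den_Fn[OF Fn.prems(1) assms(2) Fn.prems(2)]
    by (auto simp: Let_def m_def[symmetric] simp del: fv_tm.simps
        intro!: arg_cong[where f = "fun_interp M f (length xs)"])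
qed

end

section \<open>Soundness\<close>

lemma den_cong:
  "(\<And>w. w \<in> fv_tm t - set xs \<Longrightarrow> \<phi> w = \<psi> w) \<Longrightarrow> den M xs \<phi> t = den M xs \<psi> t"
proof (induction t arbitrary: xs rule: tm_induct)
  case (Fn f args)
  have "den M (rev ys @ xs) \<phi> t = den M (rev ys @ xs) \<psi> t" if "(ys, t) \<in> set args" for ys t
    using that Fn.prems by (intro Fn.IH) auto
  then show ?case by (auto intro!: arg_cong[where f = "fun_interp M f (length xs)"])
qed (simp add: den_Var)

lemma sat_cong: "(\<And>w. w \<in> fv_fm A \<Longrightarrow> \<phi> w = \<psi> w) \<Longrightarrow> sat M \<phi> A \<longleftrightarrow> sat M \<psi> A"
proof (induction A arbitrary: \<phi> \<psi>)
  case (Atom P args)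
  have "den M (rev ys) \<phi> t = den M (rev ys) \<psi> t" if "(ys, t) \<in> set args" for ys t
    using that Atom.prems by (intro den_cong) auto
  then show ?case by (auto intro!: arg_cong[where f = "pred_interp M P"])
next
  case (Forall x A)
  have "sat M (\<phi>(x := a)) A \<longleftrightarrow> sat M (\<psi>(x := a)) A" for a
    using Forall.prems by (intro Forall.IH) auto
  then show ?case by simp
next
  case (Exists x A)
  have "sat M (\<phi>(x := a)) A \<longleftrightarrow> sat M (\<psi>(x := a)) A" for a
    using Exists.prems by (intro Exists.IH) auto
  then show ?case by simp
next
  case (Imp A B)
  from Imp.IH(1)[of \<phi> \<psi>] Imp.IH(2)[of \<phi> \<psi>] Imp.prems show ?case by simp
next
  case (Conj A B)
  from Conj.IH(1)[of \<phi> \<psi>] Conj.IH(2)[of \<phi> \<psi>] Conj.prems show ?case by simp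
next
  case (Disj A B)
  from Disj.IH(1)[of \<phi> \<psi>] Disj.IH(2)[of \<phi> \<psi>] Disj.prems show ?case by simp
qed simp

lemma valid_closed:
  assumes "fv_fm A = {}" "range \<phi> \<subseteq> carr M 0"
  shows "valid M A \<longleftrightarrow> sat M \<phi> A"
proof -
  have "sat M \<psi> A \<longleftrightarrow> sat M \<phi> A" for \<psi>
    using assms(1) by (intro sat_cong) simp
  then show ?thesis using assms(2) unfolding valid_def by blast
qed

text \<open>Equality of first positions replaces the walk through the binders by name; positions are
  what \<open>den\<close> and \<open>db_of\<close> record.\<close>

lemma alpha_var_append:
  "length us = length vs \<Longrightarrow> alpha_var (us @ xs) (vs @ ys) u v \<longleftrightarrow>
    (if u \<in> set us \<or> v \<in> set vs then u \<in> set us \<and> v \<in> set vs \<and> index us u = index vs v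
     else alpha_var xs ys u v)"
  by (induction us vs rule: list_induct2) (auto simp: index_def)

lemma alpha_var_iff:
  "length us = length vs \<Longrightarrow> alpha_var us vs u v \<longleftrightarrow>
    (if u \<in> set us \<or> v \<in> set vs then u \<in> set us \<and> v \<in> set vs \<and> index us u = index vs v
     else u = v)"
  using alpha_var_append[of us vs "[]" "[]" u v] by simp

lemma map_eq_map_iff_list_all2: "map f xs = map g ys \<longleftrightarrow> list_all2 (\<lambda>x y. f x = g y) xs ys"
  proof -
  have "map f xs = map g ys \<longleftrightarrow> list_all2 (=) (map f xs) (map g ys)"
    by (simp only: list.rel_eq)
  then show ?thesis by (simp only: list.rel_map)
qed

text \<open>The bound variables are split by kind of binder. Those in \<open>xs\<close> and
  \<open>ys\<close> come from quantifiers and are interpreted by the assignments, hence the premise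
  on \<open>\<phi>\<close> and \<open>\<psi>\<close>; those in \<open>us\<close> and
  \<open>vs\<close> come from symbols and belong to the context of \<open>den\<close>.\<close>

lemma den_alpha_tm:
  assumes "\<And>u v. alpha_var xs ys u v \<Longrightarrow> \<phi> u = \<psi> v"
  shows "alpha_tm (us @ xs) (vs @ ys) s t \<Longrightarrow> length us = length vs \<Longrightarrow>
    den M us \<phi> s = den M vs \<psi> t"
proof (induction s arbitrary: us vs t rule: tm_induct)
  case (Var u)
  then obtain v where "t = Var v" by (cases t) auto
  then show ?case using Var assms
    by (auto simp: den_Var alpha_var_append split: if_splits)
next
  case (Fn f as)
  then obtain bs where t: "t = Fn f bs" and
    bs: "list_all2 (\<lambda>(us', s) (vs', t). length us' = length vs' \<and>
      alpha_tm (rev us' @ us @ xs) (rev vs' @ vs @ ys) s t) as bs"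
    by (cases t) auto
  have "list_all2 (\<lambda>a b. (case a of (us', s) \<Rightarrow> den M (rev us' @ us) \<phi> s) =
      (case b of (vs', t) \<Rightarrow> den M (rev vs' @ vs) \<psi> t)) as bs"
    using bs
  proof (rule list.rel_mono_strong, clarify)
    fix us' s vs' t
    assume "(us', s) \<in> set as" "length us' = length vs'"
      "alpha_tm (rev us' @ us @ xs) (rev vs' @ vs @ ys) s t"
    then show "den M (rev us' @ us) \<phi> s = den M (rev vs' @ vs) \<psi> t"
      using Fn.IH[of us' s "rev us' @ us" "rev vs' @ vs" t] Fn.prems(2) by simp
  qed
  then show ?case using Fn.prems(2) by (simp add: t map_eq_map_iff_list_all2[symmetric])
qed

lemma sat_alpha_fm:
  "alpha_fm xs ys A B \<Longrightarrow> (\<And>u v. alpha_var xs ys u v \<Longrightarrow> \<phi> u = \<psi> v) \<Longrightarrow>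
    sat M \<phi> A \<longleftrightarrow> sat M \<psi> B"
proof (induction xs ys A B arbitrary: \<phi> \<psi> rule: alpha_fm.induct)
  case (1 xs ys P as Q bs)
  then have "list_all2 (\<lambda>a b. (case a of (us, s) \<Rightarrow> den M (rev us) \<phi> s) =
      (case b of (vs, t) \<Rightarrow> den M (rev vs) \<psi> t)) as bs"
    by (auto elim!: list.rel_mono_strong intro!: den_alpha_tm[of xs ys])
  then show ?case using 1 by (simp add: map_eq_map_iff_list_all2[symmetric])
next
  case (6 xs ys x A y B)
  have "sat M (\<phi>(x := a)) A \<longleftrightarrow> sat M (\<psi>(y := a)) B" for a
  proof (rule "6.IH")
    show "alpha_fm (x # xs) (y # ys) A B" using "6.prems"(1) by simp
    fix u v assume "alpha_var (x # xs) (y # ys) u v"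
    then show "(\<phi>(x := a)) u = (\<psi>(y := a)) v"
      using "6.prems"(2)[of u v] by (cases "u = x \<or> v = y") auto
  qed
  then show ?case by simp
next
  case (7 xs ys x A y B)
  have "sat M (\<phi>(x := a)) A \<longleftrightarrow> sat M (\<psi>(y := a)) B" for a
  proof (rule "7.IH")
    show "alpha_fm (x # xs) (y # ys) A B" using "7.prems"(1) by simp
    fix u v assume "alpha_var (x # xs) (y # ys) u v"
    then show "(\<phi>(x := a)) u = (\<psi>(y := a)) v"
      using "7.prems"(2)[of u v] by (cases "u = x \<or> v = y") auto
  qed
  then show ?case by simp
next
  case (3 xs ys A B A' B')
  from "3.IH"(1)[of \<phi> \<psi>] "3.IH"(2)[of \<phi> \<psi>] "3.prems" show ?case by simp
next
  case (2 xs ys)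
  show ?case by simp
next
  case (4 xs ys A B A' B')
  from "4.IH"(1)[of \<phi> \<psi>] "4.IH"(2)[of \<phi> \<psi>] "4.prems" show ?case by simp
next
  case (5 xs ys A B A' B')
  from "5.IH"(1)[of \<phi> \<psi>] "5.IH"(2)[of \<phi> \<psi>] "5.prems" show ?case by simp
qed simp_all

lemma sat_alpha_eq: "alpha_eq A B \<Longrightarrow> sat M \<phi> A \<longleftrightarrow> sat M \<phi> B"
  unfolding alpha_eq_def by (rule sat_alpha_fm) auto

section \<open>Substitution in propositions and soundness of the rules\<close>

context binding_model
begin

lemma den_Nil_Var: "range \<phi> \<subseteq> carr M 0 \<Longrightarrow> den M [] \<phi> (Var w) = \<phi> w"
  using box_id[of "\<phi> w" 0] by (auto simp: den_Var)

text \<open>An argument of an atom starts in the empty context, so the linking tuple is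
  \<open>[]\<close>. Its lift is the list of all projections, which \<open>box_id\<close>
  removes.\<close>

lemma den_subst_Nil:
  assumes \<phi>: "range \<phi> \<subseteq> carr M 0" and \<psi>: "range \<psi> \<subseteq> carr M 0" and t: "wf_tm L t"
    and m: "\<And>w v. w \<in> fv_tm t - set ys \<Longrightarrow> v \<in> fv_tm (\<sigma> w) \<Longrightarrow> v < m"
    and wf: "\<And>w. w \<in> fv_tm t - set ys \<Longrightarrow> wf_tm L (\<sigma> w)"
    and \<sigma>: "\<And>w. w \<in> fv_tm t - set ys \<Longrightarrow> den M [] \<phi> (\<sigma> w) = \<psi> w"
  shows "den M (rev (map ((+) m) ys)) \<phi>
      (subst_tm (\<lambda>w. if w \<in> set ys then Var (m + w) else \<sigma> w) t) = den M (rev ys) \<psi> t"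
proof -
  have "box M (length ys) (length ys) (den M (rev ys) \<psi> t) (lift M 0 (length ys) []) = den M (rev ys) \<psi> t"
    using den_closed[OF \<psi> t, of "rev ys"] box_id[of "den M (rev ys) \<psi> t" "length ys"] by (simp add: lift_def del: upt_Suc)
  moreover have "den M (rev (map ((+) m) ys)) \<phi>
      (subst_tm (\<lambda>w. if w \<in> set ys then Var (m + w) else \<sigma> w) t) =
    box M (length (rev (map ((+) m) ys))) (length (rev ys)) (den M (rev ys) \<psi> t) (lift M 0 (length ys) [])"
  proof (rule den_subst_tm[OF \<phi> \<psi> t])
    show "lift M 0 (length ys) [] \<in> tuples M (length (rev (map ((+) m) ys))) (length (rev ys))"
      using lift_tuple[OF Nil_tuple, of 0 "length ys"] by simp
    fix w assume w: "w \<in> fv_tm t"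
    then show "wf_tm L (if w \<in> set ys then Var (m + w) else \<sigma> w)" using wf by simp
    have \<sigma>': "den M [] \<phi> (\<sigma> w) = box M (length []) (length []) (den M [] \<psi> (Var w)) []"
      if "w \<in> fv_tm t - set ys" for w
      using \<sigma>[OF that] den_Nil_Var[OF \<psi>] box_id[of "\<psi> w" 0] \<psi> by (simp add: image_subset_iff)
    show "den M (rev (map ((+) m) ys)) \<phi> (if w \<in> set ys then Var (m + w) else \<sigma> w) =
      box M (length (rev (map ((+) m) ys))) (length (rev ys)) (den M (rev ys) \<psi> (Var w))
        (lift M 0 (length ys) [])"
      using den_subst_arg[of \<phi> \<psi> "[]" "[]" "[]" t ys \<sigma> m, OF \<phi> \<psi> _ m wf \<sigma>' w] by simp
  qed
  ultimately show ?thesis by simp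
qed

lemma sat_subst_fm:
  assumes "wf_fm L A" "range \<phi> \<subseteq> carr M 0" "range \<psi> \<subseteq> carr M 0"
    and "\<And>w. w \<in> fv_fm A \<Longrightarrow> wf_tm L (\<sigma> w)"
    and "\<And>w. w \<in> fv_fm A \<Longrightarrow> den M [] \<phi> (\<sigma> w) = \<psi> w"
  shows "sat M \<phi> (subst_fm \<sigma> A) \<longleftrightarrow> sat M \<psi> A"
proof -
  \<comment> \<open>Common to both quantifiers. The renamed variable \<open>m + x\<close> is not
    free in any \<open>\<sigma> w\<close> with \<open>w\<close> other than \<open>x\<close>, so
    changing \<open>\<phi>\<close> there leaves those denotations unchanged.\<close>
  have quantifier: "sat M (\<phi>(m + x := a)) (subst_fm (\<sigma>(x := Var (m + x))) A) \<longleftrightarrow> sat M (\<psi>(x := a)) A"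
    if IH: "\<And>\<phi> \<psi> \<sigma>. wf_fm L A \<Longrightarrow> range \<phi> \<subseteq> carr M 0 \<Longrightarrow> range \<psi> \<subseteq> carr M 0 \<Longrightarrow>
          (\<And>w. w \<in> fv_fm A \<Longrightarrow> wf_tm L (\<sigma> w)) \<Longrightarrow>
          (\<And>w. w \<in> fv_fm A \<Longrightarrow> den M [] \<phi> (\<sigma> w) = \<psi> w) \<Longrightarrow>
          sat M \<phi> (subst_fm \<sigma> A) \<longleftrightarrow> sat M \<psi> A"
      and A: "wf_fm L A" and ranges: "range \<phi> \<subseteq> carr M 0" "range \<psi> \<subseteq> carr M 0"
      and wf: "\<And>w. w \<in> fv_fm A - {x} \<Longrightarrow> wf_tm L (\<sigma> w)"
      and den: "\<And>w. w \<in> fv_fm A - {x} \<Longrightarrow> den M [] \<phi> (\<sigma> w) = \<psi> w"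
      and m: "m = upper (\<Union>w \<in> fv_fm A - {x}. fv_tm (\<sigma> w))"
      and a: "a \<in> carr M 0"
    for x a m A \<sigma> and \<phi> \<psi> :: "nat \<Rightarrow> 'u"
  proof (rule IH[OF A])
    show \<phi>': "range (\<phi>(m + x := a)) \<subseteq> carr M 0" and "range (\<psi>(x := a)) \<subseteq> carr M 0"
      using ranges a by auto
    fix w assume w: "w \<in> fv_fm A"
    show "wf_tm L ((\<sigma>(x := Var (m + x))) w)" using w wf by simp
    show "den M [] (\<phi>(m + x := a)) ((\<sigma>(x := Var (m + x))) w) = (\<psi>(x := a)) w"
    proof (cases "w = x")
      case True
      then show ?thesis using den_Nil_Var[OF \<phi>'] by simp
    next
      case False
      have "v < m" if "v \<in> fv_tm (\<sigma> w)" for v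
        unfolding m using that w False by (intro less_upper) auto
      then have "den M [] (\<phi>(m + x := a)) (\<sigma> w) = den M [] \<phi> (\<sigma> w)"
        by (intro den_cong) auto
      then show ?thesis using den[of w] w False by simp
    qed
  qed
  show ?thesis using assms
  proof (induction A arbitrary: \<phi> \<psi> \<sigma>)
    case (Atom P args)
    define m where "m = upper (\<Union>w \<in> fv_fm (Atom P args :: ('f, 'p) fm). fv_tm (\<sigma> w))"
    have "den M (rev (map ((+) m) ys)) \<phi>
        (subst_tm (\<lambda>w. if w \<in> set ys then Var (m + w) else \<sigma> w) t) = den M (rev ys) \<psi> t"
      if yt: "(ys, t) \<in> set args" for ys t
    proof (rule den_subst_Nil[OF Atom.prems(2,3)])
      show "wf_tm L t" using yt Atom.prems(1) by auto
      fix w assume "w \<in> fv_tm t - set ys"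
      then have w: "w \<in> fv_fm (Atom P args :: ('f, 'p) fm)" using yt by auto
      then show "v < m" if "v \<in> fv_tm (\<sigma> w)" for v
        unfolding m_def using that by (intro less_upper) (auto simp del: fv_fm.simps)
      show "wf_tm L (\<sigma> w)" "den M [] \<phi> (\<sigma> w) = \<psi> w" using w Atom.prems by auto
    qed
    then show ?case
      by (auto simp: Let_def m_def[symmetric] simp del: fv_fm.simps
          intro!: arg_cong[where f = "pred_interp M P"])
  next
    case (Forall x A)
    define m where "m = upper (\<Union>w \<in> fv_fm A - {x}. fv_tm (\<sigma> w))"
    have "sat M (\<phi>(m + x := a)) (subst_fm (\<sigma>(x := Var (m + x))) A) \<longleftrightarrow> sat M (\<psi>(x := a)) A"
      if "a \<in> carr M 0" for a
      using Forall.prems by (intro quantifier[OF Forall.IH _ _ _ _ _ m_def that]) auto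
    then show ?case by (simp add: Let_def m_def[symmetric])
  next
    case (Exists x A)
    define m where "m = upper (\<Union>w \<in> fv_fm A - {x}. fv_tm (\<sigma> w))"
    have "sat M (\<phi>(m + x := a)) (subst_fm (\<sigma>(x := Var (m + x))) A) \<longleftrightarrow> sat M (\<psi>(x := a)) A"
      if "a \<in> carr M 0" for a
      using Exists.prems by (intro quantifier[OF Exists.IH _ _ _ _ _ m_def that]) auto
    then show ?case by (simp add: Let_def m_def[symmetric])
  next
    case (Imp A B)
    show ?case using Imp.IH[of \<phi> \<psi> \<sigma>] Imp.prems by simp
  next
    case (Conj A B)
    show ?case using Conj.IH[of \<phi> \<psi> \<sigma>] Conj.prems by simp
  next
    case (Disj A B)
    show ?case using Disj.IH[of \<phi> \<psi> \<sigma>] Disj.prems by simp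
  qed simp
qed

lemma sat_subst:
  assumes "wf_fm L A" "wf_tm L t" "range \<phi> \<subseteq> carr M 0"
  shows "sat M \<phi> (subst t x A) \<longleftrightarrow> sat M (\<phi>(x := den M [] \<phi> t)) A"
  unfolding subst_def
proof (rule sat_subst_fm)
  show "range (\<phi>(x := den M [] \<phi> t)) \<subseteq> carr M 0"
    using assms den_closed[OF assms(3,2), of "[]"] by auto
qed (use assms den_Nil_Var[OF assms(3)] in auto)

lemma sat_update_fresh: "x \<notin> fv_fm A \<Longrightarrow> sat M (\<phi>(x := a)) A \<longleftrightarrow> sat M \<phi> A"
  by (rule sat_cong) auto

lemma rel_mset_witness: "rel_mset R X Y \<Longrightarrow> x \<in># X \<Longrightarrow> \<exists>y\<in>#Y. R x y"
  unfolding rel_mset_def by (metis in_set_conv_nth list_all2_conv_all_nth set_mset_mset)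

text \<open>Open sequents and arbitrary assignments are covered because the eigenvariable rules use
  their premise at \<open>\<phi>(x := a)\<close>; the side propositions do not notice the
  change.\<close>

theorem soundness:
  "provable L \<Gamma> \<Delta> \<Longrightarrow> range \<phi> \<subseteq> carr M 0 \<Longrightarrow> \<forall>A \<in># \<Gamma>. sat M \<phi> A \<Longrightarrow> \<exists>B \<in># \<Delta>. sat M \<phi> B"
proof (induction arbitrary: \<phi> rule: provable.induct)
  case (alpha \<Gamma> \<Delta> \<Gamma>' \<Delta>')
  have "sat M \<phi> A" if A: "A \<in># \<Gamma>" for A
  proof -
    obtain A' where "A' \<in># \<Gamma>'" "alpha_eq A A'"
      using rel_mset_witness[OF alpha.hyps(2) A] by blast
    then show ?thesis using alpha.prems(2) sat_alpha_eq by blast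
  qed
  then obtain B where B: "B \<in># \<Delta>" "sat M \<phi> B"
    using alpha.IH[OF alpha.prems(1)] by blast
  obtain B' where "B' \<in># \<Delta>'" "alpha_eq B B'"
    using rel_mset_witness[OF alpha.hyps(3) B(1)] by blast
  then show ?case using B(2) sat_alpha_eq by blast
next
  case (forall_left t x A \<Gamma> \<Delta>)
  have "den M [] \<phi> t \<in> carr M 0"
    using den_closed[OF forall_left.prems(1) forall_left.hyps(2), of "[]"] by simp
  then have "sat M \<phi> (subst t x A)"
    using forall_left by (simp add: sat_subst)
  then show ?case using forall_left by simp
next
  case (forall_right \<Gamma> A \<Delta> x)
  have "sat M (\<phi>(x := a)) A \<or> (\<exists>B \<in># \<Delta>. sat M \<phi> B)" if "a \<in> carr M 0" for a
  proof -
    have "range (\<phi>(x := a)) \<subseteq> carr M 0" using that forall_right.prems(1) by auto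
    from forall_right.IH[OF this] show ?thesis
      using forall_right.hyps forall_right.prems sat_update_fresh[of x _ \<phi> a] by (auto simp del: fun_upd_apply)
  qed
  then show ?case by auto
next
  case (exists_left A \<Gamma> \<Delta> x)
  then obtain a where a: "a \<in> carr M 0" "sat M (\<phi>(x := a)) A" by auto
  then have "range (\<phi>(x := a)) \<subseteq> carr M 0" using exists_left.prems(1) by auto
  from exists_left.IH[OF this] show ?case
    using exists_left.hyps exists_left.prems sat_update_fresh[of x _ \<phi> a] a by (auto simp del: fun_upd_apply)
next
  case (exists_right \<Gamma> t x A \<Delta>)
  have "den M [] \<phi> t \<in> carr M 0"
    using den_closed[OF exists_right.prems(1) exists_right.hyps(2), of "[]"] by simp
  moreover have "sat M \<phi> (subst t x A) \<longleftrightarrow> sat M (\<phi>(x := den M [] \<phi> t)) A"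
    using exists_right by (simp add: sat_subst)
  ultimately show ?case using exists_right.IH[OF exists_right.prems] by auto
next
  case (cut A \<Gamma> \<Delta>)
  from cut.IH(1)[of \<phi>] cut.IH(2)[of \<phi>] cut.prems show ?case by auto
next
  case (imp_left \<Gamma> A \<Delta> B)
  from imp_left.IH(1)[of \<phi>] imp_left.IH(2)[of \<phi>] imp_left.prems show ?case by auto
next
  case (imp_right A \<Gamma> B \<Delta>)
  from imp_right.IH[of \<phi>] imp_right.prems show ?case by auto
next
  case (conj_right \<Gamma> A \<Delta> B)
  from conj_right.IH(1)[of \<phi>] conj_right.IH(2)[of \<phi>] conj_right.prems show ?case by auto
next
  case (disj_left A \<Gamma> \<Delta> B)
  from disj_left.IH(1)[of \<phi>] disj_left.IH(2)[of \<phi>] disj_left.prems show ?case by auto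
next
  case (conj_left A B \<Gamma> \<Delta>)
  from conj_left.IH[of \<phi>] conj_left.prems show ?case by auto
next
  case (disj_right \<Gamma> A B \<Delta>)
  from disj_right.IH[of \<phi>] disj_right.prems show ?case by auto
next
  case (contr_right \<Gamma> A \<Delta>)
  from contr_right.IH[of \<phi>] contr_right.prems show ?case by auto
next
  case (weak_right \<Gamma> \<Delta> A)
  from weak_right.IH[of \<phi>] weak_right.prems show ?case by auto
next
  case (contr_left A \<Gamma> \<Delta>)
  from contr_left.IH[of \<phi>] contr_left.prems show ?case by simp
next
  case (weak_left \<Gamma> \<Delta> A)
  from weak_left.IH[of \<phi>] weak_left.prems show ?case by simp
qed simp_all

end

section \<open>Henkin extensions\<close>

lemma alpha_tm_refl: "alpha_tm xs xs t t"
proof (induction t arbitrary: xs rule: tm_induct)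
  case (Var x)
  then show ?case by (simp add: alpha_var_iff)
next
  case (Fn f args)
  then show ?case by (auto intro!: list.rel_refl_strong)
qed

lemma alpha_fm_refl: "alpha_fm xs xs A A"
  by (induction A arbitrary: xs) (auto intro!: list.rel_refl_strong alpha_tm_refl)

lemma alpha_eq_refl: "alpha_eq A A"
  by (simp add: alpha_eq_def alpha_fm_refl)

text \<open>The bound \<open>v < m\<close> separates the images of free variables from the renamed
  binders, which are all at least \<open>m\<close>; the binders themselves match by
  position.\<close>

lemma alpha_var_subst:
  assumes "\<And>w. w \<in> fv_tm t - set ys \<Longrightarrow> \<exists>v. \<sigma> w = Var v \<and> v < m \<and> alpha_var xs zs v w"
    and "w \<in> fv_tm t"
  shows "\<exists>v. (if w \<in> set ys then Var (m + w) else \<sigma> w) = Var v \<and>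
    alpha_var (rev (map ((+) m) ys) @ xs) (rev ys @ zs) v w"
proof (cases "w \<in> set ys")
  case True
  then show ?thesis using index_map[of "(+) m" "rev ys" w]
    by (simp add: alpha_var_append rev_map)
next
  case False
  then obtain v where "\<sigma> w = Var v" "v < m" "alpha_var xs zs v w" using assms by auto
  then show ?thesis using False by (auto simp: alpha_var_append)
qed

text \<open>Two lists of binders allow the substitution to be a renaming already matched outside the
  term. That is how a renamed quantifier will be compared with the original.\<close>

lemma alpha_subst_tm:
  "(\<And>w. w \<in> fv_tm t \<Longrightarrow> \<exists>v. \<sigma> w = Var v \<and> alpha_var xs zs v w) \<Longrightarrow>
    alpha_tm xs zs (subst_tm \<sigma> t) t"
proof (induction t arbitrary: xs zs \<sigma> rule: tm_induct)
  case (Var x)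
  then show ?case by force
next
  case (Fn f args)
  define m where "m = upper (\<Union>w \<in> fv_tm (Fn f args). fv_tm (\<sigma> w))"
  have "alpha_tm (rev (map ((+) m) ys) @ xs) (rev ys @ zs)
      (subst_tm (\<lambda>w. if w \<in> set ys then Var (m + w) else \<sigma> w) t) t"
    if yt: "(ys, t) \<in> set args" for ys t
  proof (rule Fn.IH[OF yt], rule alpha_var_subst)
    fix w assume "w \<in> fv_tm t - set ys"
    then have w: "w \<in> fv_tm (Fn f args)" using yt by auto
    then obtain v where "\<sigma> w = Var v" "alpha_var xs zs v w" using Fn.prems by blast
    moreover have "v < m" unfolding m_def
      using w \<open>\<sigma> w = Var v\<close> by (intro less_upper) (auto simp del: fv_tm.simps(2) intro!: bexI[of _ w])
    ultimately show "\<exists>v. \<sigma> w = Var v \<and> v < m \<and> alpha_var xs zs v w" by blast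
  qed
  then show ?case
    by (auto simp: Let_def m_def[symmetric] list.rel_map case_prod_unfold simp del: fv_tm.simps
        intro!: list.rel_refl_strong)
qed

lemma alpha_subst_fm:
  fixes A :: "('f, 'p) fm"
  shows "(\<And>w. w \<in> fv_fm A \<Longrightarrow> \<exists>v. \<sigma> w = Var v \<and> alpha_var xs zs v w) \<Longrightarrow>
    alpha_fm xs zs (subst_fm \<sigma> A) A"
proof -
  have quantifier: "\<exists>v. (\<sigma>(x := Var (m + x))) w = Var v \<and> alpha_var ((m + x) # xs) (x # zs) v w"
    if \<sigma>: "\<And>w. w \<in> fv_fm A - {x} \<Longrightarrow> \<exists>v. \<sigma> w = Var v \<and> alpha_var xs zs v w"
      and m: "m = upper (\<Union>w \<in> fv_fm A - {x}. fv_tm (\<sigma> w))" and w: "w \<in> fv_fm A"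
    for \<sigma> xs zs x m w and A :: "('f, 'p) fm"
  proof (cases "w = x")
    case False
    then obtain v where v: "\<sigma> w = Var v" "alpha_var xs zs v w" using \<sigma>[of w] w by auto
    moreover have "v < m" unfolding m
      using v w False by (intro less_upper) (auto intro!: bexI[of _ w])
    ultimately show ?thesis using False by simp
  qed simp
  show "(\<And>w. w \<in> fv_fm A \<Longrightarrow> \<exists>v. \<sigma> w = Var v \<and> alpha_var xs zs v w) \<Longrightarrow>
    alpha_fm xs zs (subst_fm \<sigma> A) A"
  proof (induction A arbitrary: \<sigma> xs zs)
    case (Atom P args)
    define m where "m = upper (\<Union>w \<in> fv_fm (Atom P args :: ('f, 'p) fm). fv_tm (\<sigma> w))"
    have "alpha_tm (rev (map ((+) m) ys) @ xs) (rev ys @ zs)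
        (subst_tm (\<lambda>w. if w \<in> set ys then Var (m + w) else \<sigma> w) t) t"
      if yt: "(ys, t) \<in> set args" for ys t
    proof (rule alpha_subst_tm, rule alpha_var_subst)
      fix w assume "w \<in> fv_tm t - set ys"
      then have w: "w \<in> fv_fm (Atom P args :: ('f, 'p) fm)" using yt by auto
      then obtain v where "\<sigma> w = Var v" "alpha_var xs zs v w" using Atom.prems by blast
      moreover have "v < m" unfolding m_def
        using w \<open>\<sigma> w = Var v\<close> by (intro less_upper) (auto simp del: fv_fm.simps intro!: bexI[of _ w])
      ultimately show "\<exists>v. \<sigma> w = Var v \<and> v < m \<and> alpha_var xs zs v w" by blast
    qed
    then show ?case
      by (auto simp: Let_def m_def[symmetric] list.rel_map case_prod_unfold simp del: fv_fm.simps
          intro!: list.rel_refl_strong)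
  next
    case (Forall x A)
    define m where "m = upper (\<Union>w \<in> fv_fm A - {x}. fv_tm (\<sigma> w))"
    have "alpha_fm ((m + x) # xs) (x # zs) (subst_fm (\<sigma>(x := Var (m + x))) A) A"
      using Forall.prems by (intro Forall.IH quantifier[OF _ m_def]) auto
    then show ?case by (simp add: Let_def m_def[symmetric])
  next
    case (Exists x A)
    define m where "m = upper (\<Union>w \<in> fv_fm A - {x}. fv_tm (\<sigma> w))"
    have "alpha_fm ((m + x) # xs) (x # zs) (subst_fm (\<sigma>(x := Var (m + x))) A) A"
      using Exists.prems by (intro Exists.IH quantifier[OF _ m_def]) auto
    then show ?case by (simp add: Let_def m_def[symmetric])
  qed simp_all
qed

text \<open>The lists \<open>[y]\<close> and \<open>[x]\<close> stand for the quantifiers about to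
  be put in front. The choice \<open>y = x\<close> is allowed; any other \<open>y\<close> must not
  occur free, or the new quantifier would capture it.\<close>

lemma alpha_fm_rename:
  assumes "y \<notin> fv_fm A - {x}"
  shows "alpha_fm [y] [x] (subst (Var y) x A) A"
  unfolding subst_def using assms by (intro alpha_subst_fm) auto

lemma alpha_eq_rename_Forall:
  "y \<notin> fv_fm (Forall x A) \<Longrightarrow> alpha_eq (Forall y (subst (Var y) x A)) (Forall x A)"
  by (simp add: alpha_eq_def alpha_fm_rename)

lemma alpha_eq_rename_Exists:
  "y \<notin> fv_fm (Exists x A) \<Longrightarrow> alpha_eq (Exists y (subst (Var y) x A)) (Exists x A)"
  by (simp add: alpha_eq_def alpha_fm_rename)

section \<open>Derived structural rules\<close>

lemma provable_alpha_left:
  assumes "provable L (add_mset A \<Gamma>) \<Delta>" "alpha_eq A A'" "wf_fm L A'" "\<forall>B \<in># \<Gamma> + \<Delta>. wf_fm L B"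
  shows "provable L (add_mset A' \<Gamma>) \<Delta>"
  using assms
  by (intro alpha[OF assms(1)]) (auto intro!: rel_mset_Plus multiset.rel_refl alpha_eq_refl)

lemma provable_alpha_right:
  assumes "provable L \<Gamma> (add_mset A \<Delta>)" "alpha_eq A A'" "wf_fm L A'" "\<forall>B \<in># \<Gamma> + \<Delta>. wf_fm L B"
  shows "provable L \<Gamma> (add_mset A' \<Delta>)"
  using assms
  by (intro alpha[OF assms(1)]) (auto intro!: rel_mset_Plus multiset.rel_refl alpha_eq_refl)

lemma provable_weaken:
  assumes "provable L \<Gamma> \<Delta>" "\<forall>A \<in># \<Gamma>' + \<Delta>'. wf_fm L A"
  shows "provable L (\<Gamma> + \<Gamma>') (\<Delta> + \<Delta>')"
proof -
  have "(\<forall>A \<in># \<Gamma>'. wf_fm L A) \<Longrightarrow> provable L (\<Gamma> + \<Gamma>') \<Delta>"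
    by (induction \<Gamma>') (use assms(1) in \<open>auto intro: weak_left\<close>)
  then have *: "provable L (\<Gamma> + \<Gamma>') \<Delta>" using assms(2) by simp
  have "(\<forall>A \<in># \<Delta>'. wf_fm L A) \<Longrightarrow> provable L (\<Gamma> + \<Gamma>') (\<Delta> + \<Delta>')"
    by (induction \<Delta>') (use * in \<open>auto intro: weak_right\<close>)
  then show ?thesis using assms(2) by simp
qed

lemma provable_contract_left:
  "provable L (\<Gamma> + \<Gamma>') \<Delta> \<Longrightarrow> set_mset \<Gamma> \<subseteq> set_mset \<Gamma>' \<Longrightarrow> provable L \<Gamma>' \<Delta>"
proof (induction \<Gamma>)
  case (add A \<Gamma>)
  then obtain \<Theta> where "\<Gamma> + \<Gamma>' = add_mset A \<Theta>"
    by (metis insert_subset multi_member_split set_mset_add_mset_insert union_iff)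
  then show ?case using add contr_left[of L A \<Theta> \<Delta>] by simp
qed simp

lemma provable_contract_right:
  "provable L \<Gamma> (\<Delta> + \<Delta>') \<Longrightarrow> set_mset \<Delta> \<subseteq> set_mset \<Delta>' \<Longrightarrow> provable L \<Gamma> \<Delta>'"
proof (induction \<Delta>)
  case (add A \<Delta>)
  then obtain \<Theta> where "\<Delta> + \<Delta>' = add_mset A \<Theta>"
    by (metis insert_subset multi_member_split set_mset_add_mset_insert union_iff)
  then show ?case using add contr_right[of L \<Gamma> A \<Theta>] by simp
qed simp

text \<open>Weakening by all of \<open>\<Gamma>'\<close> and \<open>\<Delta>'\<close> followed by
  contraction shows that multiplicities do not matter. This justifies stating consistency for
  sets.\<close>

lemma provable_mono:
  assumes "provable L \<Gamma> \<Delta>" "set_mset \<Gamma> \<subseteq> set_mset \<Gamma>'" "set_mset \<Delta> \<subseteq> set_mset \<Delta>'"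
    and "\<forall>A \<in># \<Gamma>' + \<Delta>'. wf_fm L A"
  shows "provable L \<Gamma>' \<Delta>'"
  using provable_weaken[OF assms(1,4)] assms(2,3)
  by (blast intro: provable_contract_left provable_contract_right)

text \<open>A sequent is finite, so some \<open>y\<close> is fresh for it. If the instance at
  \<open>y\<close> made it provable, the eigenvariable rule would yield an existential
  alpha-equivalent to \<open>A\<close>, and contraction would merge it with the copy of
  \<open>A\<close> that was kept. \<open>witness_right\<close> is dual.\<close>

lemma witness_left:
  assumes np: "\<not> provable L (add_mset A \<Gamma>) \<Delta>" and wf: "\<forall>B \<in># add_mset A \<Gamma> + \<Delta>. wf_fm L B"
    and A: "A = Exists x B"
  shows "\<exists>y. \<not> provable L (add_mset (subst (Var y) x B) (add_mset A \<Gamma>)) \<Delta>"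
proof -
  obtain y where y: "y \<notin> (\<Union>C \<in> set_mset (add_mset A \<Gamma> + \<Delta>). fv_fm C)"
    by (rule fresh_variable[of "\<Union>C \<in> set_mset (add_mset A \<Gamma> + \<Delta>). fv_fm C"]) auto
  have "\<not> provable L (add_mset (subst (Var y) x B) (add_mset A \<Gamma>)) \<Delta>"
  proof
    assume "provable L (add_mset (subst (Var y) x B) (add_mset A \<Gamma>)) \<Delta>"
    then have "provable L (add_mset (Exists y (subst (Var y) x B)) (add_mset A \<Gamma>)) \<Delta>"
      using y by (intro exists_left) auto
    then have "provable L (add_mset A (add_mset A \<Gamma>)) \<Delta>"
      using y wf A by (elim provable_alpha_left) (auto intro!: alpha_eq_rename_Exists)
    then show False using np contr_left by blast
  qed
  then show ?thesis ..
qed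

lemma witness_right:
  assumes np: "\<not> provable L \<Gamma> (add_mset A \<Delta>)" and wf: "\<forall>B \<in># add_mset A \<Gamma> + \<Delta>. wf_fm L B"
    and A: "A = Forall x B"
  shows "\<exists>y. \<not> provable L \<Gamma> (add_mset (subst (Var y) x B) (add_mset A \<Delta>))"
proof -
  obtain y where y: "y \<notin> (\<Union>C \<in> set_mset (add_mset A \<Gamma> + \<Delta>). fv_fm C)"
    by (rule fresh_variable[of "\<Union>C \<in> set_mset (add_mset A \<Gamma> + \<Delta>). fv_fm C"]) auto
  have "\<not> provable L \<Gamma> (add_mset (subst (Var y) x B) (add_mset A \<Delta>))"
  proof
    assume "provable L \<Gamma> (add_mset (subst (Var y) x B) (add_mset A \<Delta>))"
    then have "provable L \<Gamma> (add_mset (Forall y (subst (Var y) x B)) (add_mset A \<Delta>))"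
      using y by (intro forall_right) auto
    then have "provable L \<Gamma> (add_mset A (add_mset A \<Delta>))"
      using y wf A by (elim provable_alpha_right) (auto intro!: alpha_eq_rename_Forall)
    then show False using np contr_right by blast
  qed
  then show ?thesis ..
qed

text \<open>Provability is that of \<open>L\<close>, although the sets will contain only
  propositions over the symbols of one sequent. Multisets are finite, so finite approximations are
  built in.\<close>

definition consistent ::
  "('f, 'p) language \<Rightarrow> ('f, 'p) fm set \<Rightarrow> ('f, 'p) fm set \<Rightarrow> bool" where
  "consistent L G D \<longleftrightarrow>
    (\<forall>\<Gamma> \<Delta>. set_mset \<Gamma> \<subseteq> G \<longrightarrow> set_mset \<Delta> \<subseteq> D \<longrightarrow> \<not> provable L \<Gamma> \<Delta>)"

text \<open>Witnesses are demanded only for existentials on the left and universals on the right;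
  the dual cases are governed by the quantifier rules for all terms.\<close>

definition decides :: "('f, 'p) fm set \<Rightarrow> ('f, 'p) fm set \<Rightarrow> ('f, 'p) fm \<Rightarrow> bool" where
  "decides G D A \<longleftrightarrow>
    A \<in> G \<and> (\<forall>x B. A = Exists x B \<longrightarrow> (\<exists>y. subst (Var y) x B \<in> G)) \<or>
    A \<in> D \<and> (\<forall>x B. A = Forall x B \<longrightarrow> (\<exists>y. subst (Var y) x B \<in> D))"

lemma henkin_step:
  assumes np: "\<not> provable L \<Gamma> \<Delta>" and sub: "set_mset (\<Gamma> + \<Delta>) \<subseteq> F"
    and wf: "\<forall>A \<in> F. wf_fm L A"
    and closed: "\<forall>x y A. Exists x A \<in> F \<or> Forall x A \<in> F \<longrightarrow> subst (Var y) x A \<in> F"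
    and A: "A \<in> F"
  shows "\<exists>\<Gamma>' \<Delta>'. \<not> provable L \<Gamma>' \<Delta>' \<and> set_mset (\<Gamma>' + \<Delta>') \<subseteq> F \<and>
    set_mset \<Gamma> \<subseteq> set_mset \<Gamma>' \<and> set_mset \<Delta> \<subseteq> set_mset \<Delta>' \<and>
    decides (set_mset \<Gamma>') (set_mset \<Delta>') A"
proof (cases "provable L (add_mset A \<Gamma>) \<Delta>")
  case False
  show ?thesis
  proof (cases "\<exists>x B. A = Exists x B")
    case True
    then obtain x B where AB: "A = Exists x B" by blast
    have "\<forall>B \<in># add_mset A \<Gamma> + \<Delta>. wf_fm L B" using sub wf A by auto
    from witness_left[OF False this AB] obtain y where "\<not> provable L (add_mset (subst (Var y) x B) (add_mset A \<Gamma>)) \<Delta>"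
      by auto
    then show ?thesis using AB sub A closed
      by - (rule exI[of _ "add_mset (subst (Var y) x B) (add_mset A \<Gamma>)"], rule exI[of _ \<Delta>], auto simp: decides_def)
  next
    case nex: False
    then show ?thesis using False sub A
      by - (rule exI[of _ "add_mset A \<Gamma>"], rule exI[of _ \<Delta>], auto simp: decides_def)
  qed
next
  case True
  \<comment> \<open>By cut, \<open>A\<close> can be added on at least one side.\<close>
  then have False: "\<not> provable L \<Gamma> (add_mset A \<Delta>)" using np cut by blast
  show ?thesis
  proof (cases "\<exists>x B. A = Forall x B")
    case True
    then obtain x B where AB: "A = Forall x B" by blast
    have "\<forall>B \<in># add_mset A \<Gamma> + \<Delta>. wf_fm L B" using sub wf A by auto
    from witness_right[OF False this AB] obtain y where "\<not> provable L \<Gamma> (add_mset (subst (Var y) x B) (add_mset A \<Delta>))"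
      by auto
    then show ?thesis using AB sub A closed
      by - (rule exI[of _ \<Gamma>], rule exI[of _ "add_mset (subst (Var y) x B) (add_mset A \<Delta>)"], auto simp: decides_def)
  next
    case nex: False
    then show ?thesis using False sub A
      by - (rule exI[of _ \<Gamma>], rule exI[of _ "add_mset A \<Delta>"], auto simp: decides_def)
  qed
qed

text \<open>Every stage is a finite sequent and leaves variables fresh, even though the limits
  \<open>G\<close> and \<open>D\<close> together exhaust \<open>F\<close>.\<close>

lemma henkin_extension:
  assumes np: "\<not> provable L \<Gamma> \<Delta>" and sub: "set_mset (\<Gamma> + \<Delta>) \<subseteq> F"
    and wf: "\<forall>A \<in> F. wf_fm L A"
    and closed: "\<forall>x y A. Exists x A \<in> F \<or> Forall x A \<in> F \<longrightarrow> subst (Var y) x A \<in> F"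
    and countable: "countable F"
  obtains G D where "set_mset \<Gamma> \<subseteq> G" "set_mset \<Delta> \<subseteq> D" "G \<union> D = F" "consistent L G D"
    "\<And>x B. Exists x B \<in> G \<Longrightarrow> \<exists>y. subst (Var y) x B \<in> G"
    "\<And>x B. Forall x B \<in> D \<Longrightarrow> \<exists>y. subst (Var y) x B \<in> D"
proof -
  define P where "P = (\<lambda>(n :: nat) (\<Gamma>', \<Delta>'). \<not> provable L \<Gamma>' \<Delta>' \<and> set_mset (\<Gamma>' + \<Delta>') \<subseteq> F \<and>
    set_mset \<Gamma> \<subseteq> set_mset \<Gamma>' \<and> set_mset \<Delta> \<subseteq> set_mset \<Delta>')"
  \<comment> \<open>Stage \<open>n\<close> decides proposition \<open>n\<close> of an enumeration of
    \<open>F\<close>. For empty \<open>F\<close> the enumerated value is arbitrary, hence the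
    guard.\<close>
  define Q where "Q = (\<lambda>n (\<Gamma>, \<Delta>) (\<Gamma>', \<Delta>').
    set_mset \<Gamma> \<subseteq> set_mset \<Gamma>' \<and> set_mset \<Delta> \<subseteq> set_mset \<Delta>' \<and>
    (from_nat_into F n \<in> F \<longrightarrow> decides (set_mset \<Gamma>') (set_mset \<Delta>') (from_nat_into F n)))"
  have "\<exists>f. \<forall>n. P n (f n) \<and> Q n (f n) (f (Suc n))"
  proof (rule dependent_nat_choice)
    show "\<exists>x. P 0 x" using np sub by (intro exI[of _ "(\<Gamma>, \<Delta>)"]) (simp add: P_def)
    fix S :: "('a, 'b) fm multiset \<times> ('a, 'b) fm multiset" and n
    obtain \<Gamma>' \<Delta>' where S: "S = (\<Gamma>', \<Delta>')" by fastforce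
    assume P: "P n S"
    show "\<exists>S'. P (Suc n) S' \<and> Q n S S'"
    proof (cases "from_nat_into F n \<in> F")
      case True
      have "\<not> provable L \<Gamma>' \<Delta>'" "set_mset (\<Gamma>' + \<Delta>') \<subseteq> F" using P by (auto simp: S P_def)
      from henkin_step[OF this wf closed True] obtain \<Gamma>'' \<Delta>'' where
        "\<not> provable L \<Gamma>'' \<Delta>'' \<and> set_mset (\<Gamma>'' + \<Delta>'') \<subseteq> F \<and>
          set_mset \<Gamma>' \<subseteq> set_mset \<Gamma>'' \<and> set_mset \<Delta>' \<subseteq> set_mset \<Delta>''" 
        "Q n S (\<Gamma>'', \<Delta>'')"
        unfolding Q_def S split by blast
      then show ?thesis using P by (intro exI[of _ "(\<Gamma>'', \<Delta>'')"]) (auto simp: S P_def)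
    next
      case False
      then show ?thesis using P by (intro exI[of _ S]) (auto simp: S P_def Q_def)
    qed
  qed
  then obtain f where f: "\<And>n. P n (f n)" "\<And>n. Q n (f n) (f (Suc n))" by blast
  define g d where "g n = set_mset (fst (f n))" and "d n = set_mset (snd (f n))" for n
  have g: "g n \<subseteq> g (Suc n)" and d: "d n \<subseteq> d (Suc n)" for n
    using f(2)[of n] by (auto simp: Q_def g_def d_def split: prod.splits)
  have g_mono: "m \<le> n \<Longrightarrow> g m \<subseteq> g n" and d_mono: "m \<le> n \<Longrightarrow> d m \<subseteq> d n" for m n
    using lift_Suc_mono_le[of g, OF g] lift_Suc_mono_le[of d, OF d] by auto
  \<comment> \<open>A finite part of the limits already lies in one stage, so a derivation from the
    limits would make that stage provable.\<close>
  have finite_sub: "\<exists>n. X \<subseteq> g n \<and> Y \<subseteq> d n"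
    if fin: "finite X" "finite Y" "X \<subseteq> (\<Union>n. g n)" "Y \<subseteq> (\<Union>n. d n)" for X Y
  proof -
    have "\<exists>n. X \<subseteq> g n" using fin(1,3)
    proof (induction X)
      case (insert A X)
      then obtain m n where "A \<in> g m" "X \<subseteq> g n" by auto
      then show ?case using g_mono[of m "max m n"] g_mono[of n "max m n"] by auto
    qed simp
    moreover have "\<exists>n. Y \<subseteq> d n" using fin(2,4)
    proof (induction Y)
      case (insert A X)
      then obtain m n where "A \<in> d m" "X \<subseteq> d n" by auto
      then show ?case using d_mono[of m "max m n"] d_mono[of n "max m n"] by auto
    qed simp
    ultimately obtain m n where "X \<subseteq> g m" "Y \<subseteq> d n" by blast
    then have "X \<subseteq> g (max m n) \<and> Y \<subseteq> d (max m n)"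
      using g_mono[of m "max m n"] d_mono[of n "max m n"] by auto
    then show ?thesis ..
  qed
  have P: "\<not> provable L (fst (f n)) (snd (f n))" "g n \<union> d n \<subseteq> F" "set_mset \<Gamma> \<subseteq> g n" "set_mset \<Delta> \<subseteq> d n"
    for n
    using f(1)[of n] by (auto simp: P_def g_def d_def split: prod.splits)
  have cons: "consistent L (\<Union>n. g n) (\<Union>n. d n)"
    unfolding consistent_def
  proof (intro allI impI notI)
    fix \<Gamma>' \<Delta>' assume \<Gamma>': "set_mset \<Gamma>' \<subseteq> (\<Union>n. g n)" "set_mset \<Delta>' \<subseteq> (\<Union>n. d n)"
      and prov: "provable L \<Gamma>' \<Delta>'"
    from finite_sub[OF _ _ \<Gamma>'] obtain n where n: "set_mset \<Gamma>' \<subseteq> g n" "set_mset \<Delta>' \<subseteq> d n" by auto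
    have "\<forall>A \<in># fst (f n) + snd (f n). wf_fm L A" using P(2)[of n] wf by (auto simp: g_def d_def)
    with provable_mono[OF prov] n P(1)[of n] show False by (auto simp: g_def d_def)
  qed
  have decided: "decides (\<Union>n. g n) (\<Union>n. d n) A" if A: "A \<in> F" for A
  proof -
    obtain n where "A = from_nat_into F n" using from_nat_into_surj[OF countable A] by metis
    then have "decides (g (Suc n)) (d (Suc n)) A"
      using f(2)[of n] A by (auto simp: Q_def g_def d_def split: prod.splits)
    then show ?thesis unfolding decides_def by blast
  qed
  \<comment> \<open>Disjointness fixes the side on which a proposition was decided: an existential
    in \<open>G\<close> cannot have been settled through \<open>D\<close> without a witness.\<close>
  have disj: "\<not> (A \<in> (\<Union>n. g n) \<and> A \<in> (\<Union>n. d n))" for A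
  proof
    assume A: "A \<in> (\<Union>n. g n) \<and> A \<in> (\<Union>n. d n)"
    then have "wf_fm L A" using P(2) wf by blast
    then show False using A cons ax[of L A] unfolding consistent_def
      by (metis empty_subsetI insert_subset set_mset_add_mset_insert set_mset_empty)
  qed
  show thesis
  proof (rule that)
    show "set_mset \<Gamma> \<subseteq> (\<Union>n. g n)" "set_mset \<Delta> \<subseteq> (\<Union>n. d n)" using P(3,4) by blast+
    show union: "(\<Union>n. g n) \<union> (\<Union>n. d n) = F" using P(2) decided unfolding decides_def by blast
    show "consistent L (\<Union>n. g n) (\<Union>n. d n)" by (rule cons)
    show "\<exists>y. subst (Var y) x B \<in> (\<Union>n. g n)" if "Exists x B \<in> (\<Union>n. g n)" for x B
      using that decided[of "Exists x B"] disj[of "Exists x B"] union by (auto simp: decides_def)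
    show "\<exists>y. subst (Var y) x B \<in> (\<Union>n. d n)" if "Forall x B \<in> (\<Union>n. d n)" for x B
      using that decided[of "Forall x B"] disj[of "Forall x B"] union by (auto simp: decides_def)
  qed
qed

section \<open>De Bruijn terms\<close>

text \<open>Named variables survive as \<open>Free\<close>, so each of them is an element of
  \<open>M_0\<close>. The indices of \<open>Bound\<close> are the arguments of an element of
  \<open>M_n\<close>, counted from 0; \<open>Op\<close> stores how many of them each argument
  binds.\<close>

datatype 'f db = Bound nat | Free nat | Op 'f "(nat \<times> 'f db) list"

lemma db_induct [case_names Bound Free Op]:
  assumes "\<And>i. P (Bound i)" and "\<And>x. P (Free x)"
    and "\<And>f as. (\<And>k d. (k, d) \<in> set as \<Longrightarrow> P d) \<Longrightarrow> P (Op f as)"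
  shows "P d"
proof (induction d)
  case (Op f as)
  show ?case by (rule assms(3)) (use Op in \<open>fastforce\<close>)
qed (rule assms(1,2))+

text \<open>Substitution must shift the terms it inserts under a binder. Treating renamings first
  supplies the shift and keeps both recursions structural.\<close>

definition up_ren :: "nat \<Rightarrow> (nat \<Rightarrow> nat) \<Rightarrow> nat \<Rightarrow> nat" where
  "up_ren k r i = (if i < k then i else r (i - k) + k)"

fun ren :: "(nat \<Rightarrow> nat) \<Rightarrow> 'f db \<Rightarrow> 'f db" where
  "ren r (Bound i) = Bound (r i)"
| "ren r (Free x) = Free x"
| "ren r (Op f as) = Op f (map (\<lambda>(k, d). (k, ren (up_ren k r) d)) as)"

text \<open>The syntactic form of \<open>lift\<close>, as \<open>box_lift_T\<close>
  confirms.\<close>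

definition up :: "nat \<Rightarrow> (nat \<Rightarrow> 'f db) \<Rightarrow> nat \<Rightarrow> 'f db" where
  "up k s i = (if i < k then Bound i else ren (\<lambda>j. j + k) (s (i - k)))"

fun sb :: "(nat \<Rightarrow> 'f db) \<Rightarrow> 'f db \<Rightarrow> 'f db" where
  "sb s (Bound i) = s i"
| "sb s (Free x) = Free x"
| "sb s (Op f as) = Op f (map (\<lambda>(k, d). (k, sb (up k s) d)) as)"

text \<open>Composition laws must pass binders in turn: \<open>ren_sb\<close> relies on
  \<open>ren_ren\<close>, and \<open>sb_sb\<close> on \<open>sb_ren\<close> and
  \<open>ren_sb\<close>. The goal is \<open>sb_sb\<close>, which becomes associativity of
  \<open>box\<close> in the term model.\<close>

lemma ren_ren: "ren r (ren r' d) = ren (\<lambda>i. r (r' i)) d"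
proof (induction d arbitrary: r r' rule: db_induct)
  case (Op f as)
  have "(\<lambda>i. up_ren k r (up_ren k r' i)) = up_ren k (\<lambda>i. r (r' i))" for k
    by (auto simp: up_ren_def)
  then show ?case using Op by auto
qed simp_all

lemma sb_ren: "sb s (ren r d) = sb (\<lambda>i. s (r i)) d"
proof (induction d arbitrary: s r rule: db_induct)
  case (Op f as)
  have "(\<lambda>i. up k s (up_ren k r i)) = up k (\<lambda>i. s (r i))" for k
    by (auto simp: up_ren_def up_def)
  then show ?case using Op by auto
qed simp_all

lemma ren_up: "(\<lambda>i. ren (up_ren k r) (up k s i)) = up k (\<lambda>i. ren r (s i))"
proof -
  have "(\<lambda>j. up_ren k r (j + k)) = (\<lambda>j. r j + k)"
    by (auto simp: up_ren_def)
  then show ?thesis by (auto simp: up_def ren_ren up_ren_def)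
qed

lemma ren_sb: "ren r (sb s d) = sb (\<lambda>i. ren r (s i)) d"
proof (induction d arbitrary: s r rule: db_induct)
  case (Op f as)
  then show ?case by (auto simp: ren_up)
qed simp_all

lemma sb_up: "(\<lambda>i. sb (up k s) (up k s' i)) = up k (\<lambda>i. sb s (s' i))"
proof -
  have "(\<lambda>j. up k s (j + k)) = (\<lambda>j. ren (\<lambda>j. j + k) (s j))"
    by (auto simp: up_def)
  then show ?thesis by (auto simp: up_def sb_ren ren_sb)
qed

lemma sb_sb: "sb s (sb s' d) = sb (\<lambda>i. sb s (s' i)) d"
proof (induction d arbitrary: s s' rule: db_induct)
  case (Op f as)
  then show ?case by (auto simp: sb_up)
qed simp_all

lemma up_Bound: "up k (\<lambda>i. Bound (r i)) = (\<lambda>i. Bound (up_ren k r i))"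
  by (auto simp: up_ren_def up_def)

lemma ren_conv_sb: "ren r d = sb (\<lambda>i. Bound (r i)) d"
proof (induction d arbitrary: r rule: db_induct)
  case (Op f as)
  then show ?case by (auto simp: up_Bound)
qed simp_all

lemma sb_Bound: "sb Bound d = d"
proof (induction d rule: db_induct)
  case (Op f as)
  have "up k Bound = (Bound :: nat \<Rightarrow> 'a db)" for k by (auto simp: up_def)
  then show ?case using Op by (auto intro!: map_idI)
qed simp_all

fun wf_db :: "('f, 'p) language \<Rightarrow> nat \<Rightarrow> 'f db \<Rightarrow> bool" where
  "wf_db L n (Bound i) \<longleftrightarrow> i < n"
| "wf_db L n (Free x) \<longleftrightarrow> True"
| "wf_db L n (Op f as) \<longleftrightarrow>
    f \<in> fun_syms L \<and> map fst as = fun_arity L f \<and> (\<forall>(k, d) \<in> set as. wf_db L (n + k) d)"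

lemma wf_db_ren: "wf_db L n d \<Longrightarrow> (\<And>i. i < n \<Longrightarrow> r i < m) \<Longrightarrow> wf_db L m (ren r d)"
proof (induction d arbitrary: n m r rule: db_induct)
  case (Op f as)
  have "wf_db L (m + k) (ren (up_ren k r) d)" if kd: "(k, d) \<in> set as" for k d
  proof (rule Op.IH[OF kd])
    show "wf_db L (n + k) d" using kd Op.prems(1) by auto
    show "up_ren k r i < m + k" if "i < n + k" for i
      using that Op.prems(2)[of "i - k"] by (auto simp: up_ren_def)
  qed
  then show ?case using Op.prems(1) by (auto simp: comp_def case_prod_unfold)
qed simp_all

lemma wf_db_sb: "wf_db L n d \<Longrightarrow> (\<And>i. i < n \<Longrightarrow> wf_db L m (s i)) \<Longrightarrow> wf_db L m (sb s d)"
proof (induction d arbitrary: n m s rule: db_induct)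
  case (Op f as)
  have "wf_db L (m + k) (sb (up k s) d)" if kd: "(k, d) \<in> set as" for k d
  proof (rule Op.IH[OF kd])
    show "wf_db L (n + k) d" using kd Op.prems(1) by auto
    show "wf_db L (m + k) (up k s i)" if "i < n + k" for i
      using that Op.prems(2)[of "i - k"] by (auto simp: up_def intro!: wf_db_ren[of L m])
  qed
  then show ?case using Op.prems(1) by (auto simp: comp_def case_prod_unfold)
qed simp_all

text \<open>A tuple acts as the function \<open>(!) cs\<close>, whose values beyond the end are
  unspecified; well-formedness at \<open>n\<close> guarantees that they are never consulted.\<close>

lemma sb_cong: "wf_db L n d \<Longrightarrow> (\<And>i. i < n \<Longrightarrow> s i = s' i) \<Longrightarrow> sb s d = sb s' d"
proof (induction d arbitrary: n s s' rule: db_induct)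
  case (Op f as)
  have "sb (up k s) d = sb (up k s') d" if kd: "(k, d) \<in> set as" for k d
  proof (rule Op.IH[OF kd])
    show "wf_db L (n + k) d" using kd Op.prems(1) by auto
    show "up k s i = up k s' i" if "i < n + k" for i
      using that Op.prems(2)[of "i - k"] by (auto simp: up_def)
  qed
  then show ?case by auto
qed simp_all

fun db_of :: "nat list \<Rightarrow> 'f tm \<Rightarrow> 'f db" where
  "db_of xs (Var y) = (if y \<in> set xs then Bound (index xs y) else Free y)"
| "db_of xs (Fn f args) = Op f (map (\<lambda>(ys, t). (length ys, db_of (rev ys @ xs) t)) args)"

lemma wf_db_of: "wf_tm L t \<Longrightarrow> wf_db L (length xs) (db_of xs t)"
proof (induction t arbitrary: xs rule: tm_induct)
  case (Var x)
  then show ?case by (simp add: index_less)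
next
  case (Fn f args)
  have "wf_db L (length xs + length ys) (db_of (rev ys @ xs) t)" if "(ys, t) \<in> set args" for ys t
    using Fn.IH[OF that, of "rev ys @ xs"] Fn.prems that by (auto simp: add.commute)
  then show ?case using Fn.prems by (auto simp: comp_def case_prod_unfold)
qed

lemma alpha_tm_of_db:
  "db_of xs s = db_of ys t \<Longrightarrow> length xs = length ys \<Longrightarrow> alpha_tm xs ys s t"
proof (induction s arbitrary: xs ys t rule: tm_induct)
  case (Var u)
  then obtain v where "t = Var v" by (cases t) (auto split: if_splits)
  then show ?case using Var by (auto simp: alpha_var_iff split: if_splits)
next
  case (Fn f as)
  then obtain bs where t: "t = Fn f bs" by (cases t) (auto split: if_splits)
  have "list_all2 (\<lambda>a b. (case a of (ys, t) \<Rightarrow> (length ys, db_of (rev ys @ xs) t)) =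
      (case b of (zs, t) \<Rightarrow> (length zs, db_of (rev zs @ ys) t))) as bs"
    using Fn.prems(1) by (simp add: t map_eq_map_iff_list_all2)
  then show ?case unfolding t alpha_tm.simps
    by (auto elim!: list.rel_mono_strong intro!: Fn.IH simp: Fn.prems(2))
qed

fun free_db :: "'f db \<Rightarrow> nat set" where
  "free_db (Bound i) = {}"
| "free_db (Free x) = {x}"
| "free_db (Op f as) = (\<Union>(k, d) \<in> set as. free_db d)"

lemma finite_free_db [simp]: "finite (free_db d)"
  by (induction d rule: db_induct) auto

text \<open>Well-formed terms need distinct variables across all arguments of a symbol, so the lists
  are consecutive intervals above \<open>N\<close>.\<close>

lemma fresh_variable_lists:
  fixes N :: nat
  shows "\<exists>yss. map length yss = ks \<and> distinct (concat yss) \<and> (\<forall>y \<in> set (concat yss). N \<le> y)"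
proof (induction ks arbitrary: N)
  case (Cons k ks)
  obtain yss where yss: "map length yss = ks" "distinct (concat yss)"
    "\<forall>y \<in> set (concat yss). N + k \<le> y" using Cons by blast
  then have "set [N..<N + k] \<inter> set (concat yss) = {}" by fastforce
  then have "map length ([N..<N + k] # yss) = k # ks \<and> distinct (concat ([N..<N + k] # yss)) \<and>
      (\<forall>y \<in> set (concat ([N..<N + k] # yss)). N \<le> y)"
    using yss by fastforce
  then show ?case by (rule exI)
qed simp

text \<open>Names have to be restored for the nameless binders. They are chosen above the context
  and the free variables, so no index is shadowed and no \<open>Free\<close> variable captured;
  distinctness of \<open>xs\<close> lets \<open>xs ! i\<close> stand for index
  \<open>i\<close>.\<close>

lemma db_of_surj:
  "wf_db L (length xs) d \<Longrightarrow> distinct xs \<Longrightarrow> set xs \<inter> free_db d = {} \<Longrightarrow>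
    \<exists>t. wf_tm L t \<and> db_of xs t = d"
proof (induction d arbitrary: xs rule: db_induct)
  case (Bound i)
  then show ?case by (intro exI[of _ "Var (xs ! i)"]) (simp add: index_nth)
next
  case (Free x)
  then show ?case by (intro exI[of _ "Var x"]) simp
next
  case (Op f as)
  define N where "N = upper (set xs \<union> free_db (Op f as))"
  have N: "y < N" if "y \<in> set xs \<union> free_db (Op f as)" for y
    unfolding N_def using that by (intro less_upper) (auto simp del: free_db.simps)
  obtain yss where yss: "map length yss = map fst as" "distinct (concat yss)"
    "\<forall>y \<in> set (concat yss). N \<le> y" using fresh_variable_lists by blast
  have len: "length yss = length as" using map_eq_imp_length_eq[OF yss(1)] .
  have "\<exists>t. wf_tm L t \<and> db_of (rev (yss ! i) @ xs) t = snd (as ! i)" if i: "i < length as" for i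
  proof -
    obtain k d where kd: "as ! i = (k, d)" by fastforce
    then have mem: "(k, d) \<in> set as" using i by (metis nth_mem)
    have "length (yss ! i) = k"
      using arg_cong[OF yss(1), of "\<lambda>l. l ! i"] i len kd by simp
    then have "wf_db L (length (rev (yss ! i) @ xs)) d"
      using Op.prems(1) mem by (auto simp: add.commute)
    moreover have fresh: "N \<le> y" if "y \<in> set (yss ! i)" for y
      using yss(3) that i len by auto
    have "distinct (yss ! i)"
      using yss(2) i len by (auto simp: distinct_concat_iff)
    then have "distinct (rev (yss ! i) @ xs)"
      using fresh N Op.prems(2) by (fastforce simp: disjoint_iff)
    moreover have "free_db d \<subseteq> free_db (Op f as)" using mem by auto
    then have "set (rev (yss ! i) @ xs) \<inter> free_db d = {}"
      using fresh N Op.prems(3) by (fastforce simp: disjoint_iff)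
    ultimately show ?thesis using Op.IH[OF mem] kd by simp
  qed
  then obtain t where t: "\<And>i. i < length as \<Longrightarrow> wf_tm L (t i) \<and> db_of (rev (yss ! i) @ xs) (t i) = snd (as ! i)"
    by metis
  define args where "args = map (\<lambda>i. (yss ! i, t i)) [0..<length as]"
  have ys: "map (\<lambda>(ys, t). ys) args = yss"
    using len by (auto simp: args_def intro: nth_equalityI)
  then have "map (\<lambda>(ys, t). length ys) args = map length yss"
    by (metis (no_types, lifting) ext case_prod_unfold list.map_comp comp_apply)
  moreover have "map (\<lambda>(ys, t). (length ys, db_of (rev ys @ xs) t)) args = as"
  proof (rule nth_equalityI)
    fix i assume "i < length (map (\<lambda>(ys, t). (length ys, db_of (rev ys @ xs) t)) args)"
    then have i: "i < length as" by (simp add: args_def)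
    then have "length (yss ! i) = fst (as ! i)"
      using arg_cong[OF yss(1), of "\<lambda>l. l ! i"] len by simp
    then show "map (\<lambda>(ys, t). (length ys, db_of (rev ys @ xs) t)) args ! i = as ! i"
      using i t by (simp add: args_def prod_eq_iff)
  qed (simp add: args_def)
  moreover have "\<forall>(ys, t) \<in> set args. wf_tm L t" using t by (auto simp: args_def)
  ultimately show ?case
    using Op.prems(1) yss ys by (intro exI[of _ "Fn f args"]) auto
qed

section \<open>The term model\<close>

definition restrict_language :: "('f, 'p) language \<Rightarrow> 'f set \<Rightarrow> 'p set \<Rightarrow> ('f, 'p) language" where
  "restrict_language L F P = L\<lparr>fun_syms := fun_syms L \<inter> F, pred_syms := pred_syms L \<inter> P\<rparr>"

lemma restrict_language_simps [simp]:
  "fun_syms (restrict_language L F P) = fun_syms L \<inter> F"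
  "pred_syms (restrict_language L F P) = pred_syms L \<inter> P"
  "fun_arity (restrict_language L F P) = fun_arity L"
  "pred_arity (restrict_language L F P) = pred_arity L"
  by (simp_all add: restrict_language_def)

lemma wf_tm_restrict: "wf_tm (restrict_language L F P) t \<longleftrightarrow> wf_tm L t \<and> set_tm t \<subseteq> F"
proof (induction t rule: tm_induct)
  case (Fn f args)
  have "(\<forall>p \<in> set args. wf_tm (restrict_language L F P) (snd p)) \<longleftrightarrow>
    (\<forall>p \<in> set args. wf_tm L (snd p)) \<and> (\<forall>p \<in> set args. set_tm (snd p) \<subseteq> F)"
    using Fn.IH by force
  then show ?case by (simp add: case_prod_unfold prod_set_defs UN_subset_iff) blast
qed simp

lemma wf_fm_restrict:
  "wf_fm (restrict_language L F P) A \<longleftrightarrow> wf_fm L A \<and> set1_fm A \<subseteq> F \<and> set2_fm A \<subseteq> P"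
proof (induction A)
  case (Atom Q args)
  have "(\<forall>p \<in> set args. wf_tm (restrict_language L F P) (snd p)) \<longleftrightarrow>
    (\<forall>p \<in> set args. wf_tm L (snd p)) \<and> (\<forall>p \<in> set args. set_tm (snd p) \<subseteq> F)"
    by (auto simp: wf_tm_restrict)
  then show ?case by (simp add: case_prod_unfold prod_set_defs UN_subset_iff) blast
qed auto

section \<open>Countability of the syntax over countably many symbols\<close>

instance tm :: (countable) countable
  by countable_datatype

instance fm :: (countable, countable) countable
  by countable_datatype

instance db :: (countable) countable
  by countable_datatype

text \<open>The symbol types may be uncountable, so the type class instance does not apply to them
  directly. Coding the relevant symbols by numbers moves the propositions injectively into a type
  where it does.\<close>

lemma countable_fm:
  assumes "countable F" "countable P"
  shows "countable {A. set1_fm A \<subseteq> F \<and> set2_fm A \<subseteq> P}"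
proof (rule countableI')
  let ?h = "to_nat \<circ> map_fm (to_nat_on F) (to_nat_on P)"
  show "inj_on ?h {A. set1_fm A \<subseteq> F \<and> set2_fm A \<subseteq> P}"
  proof (rule inj_onI, clarsimp)
    fix A B
    assume "set1_fm A \<subseteq> F" "set2_fm A \<subseteq> P" "set1_fm B \<subseteq> F" "set2_fm B \<subseteq> P"
      "map_fm (to_nat_on F) (to_nat_on P) A = map_fm (to_nat_on F) (to_nat_on P) B"
    then show "A = B"
      using assms by (auto elim!: fm.inj_map_strong[rotated 2] dest: inj_onD[OF inj_on_to_nat_on])
  qed
qed

lemma set_db_subset: "wf_db L n d \<Longrightarrow> set_db d \<subseteq> fun_syms L"
proof (induction d arbitrary: n rule: db_induct)
  case (Op f as)
  then show ?case by fastforce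
qed simp_all

lemma countable_db:
  assumes "countable (fun_syms L)"
  shows "countable {d. \<exists>n. wf_db L n d}"
proof (rule countableI')
  let ?h = "to_nat \<circ> map_db (to_nat_on (fun_syms L))"
  show "inj_on ?h {d. \<exists>n. wf_db L n d}"
  proof (rule inj_onI, clarsimp)
    fix d d' m n
    assume "wf_db L m d" "wf_db L n d'"
      and eq: "map_db (to_nat_on (fun_syms L)) d = map_db (to_nat_on (fun_syms L)) d'"
    then have "set_db d \<subseteq> fun_syms L" "set_db d' \<subseteq> fun_syms L"
      using set_db_subset by blast+
    then show "d = d'"
      using eq assms by (auto elim!: db.inj_map_strong[rotated 1] dest: inj_onD[OF inj_on_to_nat_on])
  qed
qed

lemma countable_embedding:
  assumes "infinite (UNIV :: 'u set)" "countable X"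
  obtains e :: "'a \<Rightarrow> 'u" where "inj_on e X"
proof -
  obtain h :: "nat \<Rightarrow> 'u" where "inj h"
    using infinite_countable_subset[OF assms(1)] by blast
  then have "inj_on (h \<circ> to_nat_on X) X"
    using assms(2) by (intro comp_inj_on inj_on_subset[OF \<open>inj h\<close>]) auto
  then show thesis by (rule that)
qed

text \<open>\<open>K\<close> will contain only the symbols of the given sequent, so that there are countably many de
  Bruijn terms to embed into \<open>'u\<close>. Every other function symbol denotes the constant \<open>Free 0\<close>.\<close>

locale term_structure =
  fixes K :: "('f, 'p) language"
    and G :: "('f, 'p) fm set"
    and e :: "'f db \<Rightarrow> 'u"
  assumes inj_e: "inj_on e {d. \<exists>n. wf_db K n d}"
begin

definition dec :: "'u \<Rightarrow> 'f db" where
  "dec = inv_into {d. \<exists>n. wf_db K n d} e"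

text \<open>\<open>proj\<close> counts from 1 and \<open>Bound\<close> from 0, hence
  \<open>i - 1\<close>. Predicates ask for some named atom in \<open>G\<close> with the given de
  Bruijn arguments; that the choice among such atoms is immaterial is shown in
  \<open>truth\<close>.\<close>

definition T :: "('f, 'p, 'u) binding_structure" where
  "T = \<lparr>carr = \<lambda>n. e ` {d. wf_db K n d},
    proj = \<lambda>n i. e (Bound (i - 1)),
    box = \<lambda>p n a bs. e (sb (\<lambda>i. dec (bs ! i)) (dec a)),
    fun_interp = \<lambda>f p as.
      if f \<in> fun_syms K then e (Op f (zip (fun_arity K f) (map dec as))) else e (Free 0),
    pred_interp = \<lambda>P as.
      \<exists>args. Atom P args \<in> G \<and> as = map (\<lambda>(ys, t). e (db_of (rev ys) t)) args\<rparr>"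

lemma T_simps [simp]:
  "carr T n = e ` {d. wf_db K n d}"
  "proj T n i = e (Bound (i - 1))"
  "fun_interp T f p as =
    (if f \<in> fun_syms K then e (Op f (zip (fun_arity K f) (map dec as))) else e (Free 0))"
  "pred_interp T P as \<longleftrightarrow>
    (\<exists>args. Atom P args \<in> G \<and> as = map (\<lambda>(ys, t). e (db_of (rev ys) t)) args)"
  by (simp_all add: T_def)

lemma dec: "wf_db K n d \<Longrightarrow> dec (e d) = d"
  unfolding dec_def by (rule inv_into_f_f[OF inj_e]) blast

lemma e_eq_iff: "wf_db K m c \<Longrightarrow> wf_db K n d \<Longrightarrow> e c = e d \<longleftrightarrow> c = d"
  using dec by metis

lemma tuples_T:
  assumes "bs \<in> tuples T p n"
  obtains cs where "bs = map e cs" "length cs = n" "\<And>i. i < n \<Longrightarrow> wf_db K p (cs ! i)"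
proof -
  have "bs \<in> lists (e ` {d. wf_db K p d})" using assms by (auto simp: tuples_def)
  then obtain cs where cs: "set cs \<subseteq> {d. wf_db K p d}" "bs = map e cs"
    by (auto simp: lists_image)
  have len: "length cs = n" using assms cs(2) by (simp add: tuples_def)
  show thesis
  proof (rule that[OF cs(2) len])
    show "wf_db K p (cs ! i)" if "i < n" for i
      using cs(1) len that nth_mem by blast
  qed
qed

text \<open>\<open>box\<close> in \<open>T\<close> ignores its arity labels, so \<open>q\<close> and
  \<open>r\<close> are arbitrary. The carrier index \<open>p\<close> occurs in the premises only,
  which is why uses of the lemma have to supply it.\<close>

lemma box_T:
  assumes "wf_db K n d" "length cs = n" "\<And>i. i < n \<Longrightarrow> wf_db K p (cs ! i)"
  shows "box T q r (e d) (map e cs) = e (sb ((!) cs) d)"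
proof -
  have "sb (\<lambda>i. dec (map e cs ! i)) d = sb ((!) cs) d"
    using assms by (intro sb_cong[OF assms(1)]) (auto intro: dec)
  then show ?thesis by (simp add: T_def dec[OF assms(1)])
qed

lemma map_proj_T: "map (proj T q) [Suc k..<Suc l] = map e (map Bound [k..<l])"
  by (simp add: map_Suc_upt[symmetric] comp_def del: upt_Suc)

lemma lift_T:
  assumes "\<And>i. i < length cs \<Longrightarrow> wf_db K q (cs ! i)"
  shows "lift T q k (map e cs) = map e (map Bound [0..<k] @ map (ren (\<lambda>j. j + k)) cs)"
proof -
  have "box T (q + k) q (e c) (map e (map Bound [k..<q + k])) = e (ren (\<lambda>j. j + k) c)"
    if "c \<in> set cs" for c
  proof -
    have c: "wf_db K q c" using that assms by (metis in_set_conv_nth)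
    have "sb ((!) (map Bound [k..<q + k])) c = ren (\<lambda>j. j + k) c"
      unfolding ren_conv_sb by (intro sb_cong[OF c]) (simp add: add.commute)
    then show ?thesis by (subst box_T[OF c, where p = "q + k"]) auto
  qed
  then show ?thesis
    using map_proj_T[of "q + k" 0 k] map_proj_T[of "q + k" k "q + k"]
    by (simp add: lift_def del: upt_Suc T_simps)
qed

lemma box_lift_T:
  assumes d: "wf_db K (length cs + k) d" and cs: "\<And>i. i < length cs \<Longrightarrow> wf_db K q (cs ! i)"
  shows "box T (q + k) (length cs + k) (e d) (lift T q k (map e cs)) = e (sb (up k ((!) cs)) d)"
proof -
  let ?bs = "map Bound [0..<k] @ map (ren (\<lambda>j. j + k)) cs"
  have lift: "lift T q k (map e cs) = map e ?bs" by (rule lift_T) (rule cs)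
  have "wf_db K (q + k) (?bs ! i)" if "i < length cs + k" for i
    using that cs[of "i - k"] by (auto simp: nth_append intro!: wf_db_ren[of K q])
  then have "box T (q + k) (length cs + k) (e d) (lift T q k (map e cs)) = e (sb ((!) ?bs) d)"
    unfolding lift by (intro box_T[OF d, where p = "q + k"]) auto
  also have "sb ((!) ?bs) d = sb (up k ((!) cs)) d"
    by (intro sb_cong[OF d]) (auto simp: nth_append up_def)
  finally show ?thesis .
qed

lemma intensional_functional_structure_T: "intensional_functional_structure T"
proof
  fix i n :: nat assume "1 \<le> i" "i \<le> n"
  then show "proj T n i \<in> carr T n" by auto
next
  fix a bs n p assume "a \<in> carr T n" "bs \<in> tuples T p n"
  then show "box T p n a bs \<in> carr T p"
    by (elim tuples_T) (auto simp: box_T[where p = p] intro!: imageI wf_db_sb[of K n])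
next
  fix i n bs p assume "1 \<le> i" "i \<le> n" and bs: "bs \<in> tuples T p n"
  from bs obtain cs where "bs = map e cs" "length cs = n" "\<And>i. i < n \<Longrightarrow> wf_db K p (cs ! i)"
    by (rule tuples_T) blast
  then show "box T p n (proj T n i) bs = bs ! (i - 1)"
    using \<open>1 \<le> i\<close> \<open>i \<le> n\<close> by (simp add: box_T[of n _ _ p])
next
  fix a n assume "a \<in> carr T n"
  then obtain d where d: "wf_db K n d" "a = e d" by auto
  have "box T n n (e d) (map e (map Bound [0..<n])) = e (sb ((!) (map Bound [0..<n])) d)"
    by (intro box_T[OF d(1), where p = n]) auto
  also have "sb ((!) (map Bound [0..<n])) d = d"
    by (subst (2) sb_Bound[symmetric], intro sb_cong[OF d(1)]) simp
  finally show "box T n n a (map (proj T n) [1..<Suc n]) = a"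
    using map_proj_T[of n 0 n] d(2) by simp
next
  fix a n bs p cs q
  assume "a \<in> carr T n" and bs: "bs \<in> tuples T p n" and cs: "cs \<in> tuples T q p"
  then obtain d where d: "wf_db K n d" "a = e d" by auto
  from bs obtain bs' where bs': "bs = map e bs'" "length bs' = n" "\<And>i. i < n \<Longrightarrow> wf_db K p (bs' ! i)"
    by (rule tuples_T) blast
  from cs obtain cs' where cs': "cs = map e cs'" "length cs' = p" "\<And>i. i < p \<Longrightarrow> wf_db K q (cs' ! i)"
    by (rule tuples_T) blast
  have "wf_db K p (sb ((!) bs') d)" by (rule wf_db_sb[OF d(1) bs'(3)])
  then have "box T q p (box T p n a bs) cs = e (sb ((!) cs') (sb ((!) bs') d))"
    using d bs' cs' by (simp add: box_T[of n _ _ p] box_T[of p _ _ q])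
  moreover have "map (\<lambda>b. box T q p b cs) bs = map e (map (sb ((!) cs')) bs')"
    using bs' cs' by (auto simp: box_T[of p _ _ q] in_set_conv_nth)
  moreover have "box T q n a (map e (map (sb ((!) cs')) bs')) =
      e (sb ((!) (map (sb ((!) cs')) bs')) d)"
    unfolding d(2) using bs' cs' by (intro box_T[OF d(1), where p = q]) (auto intro!: wf_db_sb[of K p])
  moreover have "sb ((!) (map (sb ((!) cs')) bs')) d = sb ((!) cs') (sb ((!) bs') d)"
    unfolding sb_sb using bs' by (intro sb_cong[OF d(1)]) simp
  ultimately show "box T q p (box T p n a bs) cs = box T q n a (map (\<lambda>b. box T q p b cs) bs)"
    by simp
qed

lemma list_all2_carr_T:
  assumes "list_all2 (\<lambda>k a. a \<in> carr T (p + k)) ks as"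
  obtains ds where "as = map e ds" "list_all2 (\<lambda>k d. wf_db K (p + k) d) ks ds"
proof -
  have "\<forall>i < length ks. \<exists>d. as ! i = e d \<and> wf_db K (p + ks ! i) d"
    using assms by (auto simp: list_all2_conv_all_nth)
  then obtain d where d: "\<And>i. i < length ks \<Longrightarrow> as ! i = e (d i) \<and> wf_db K (p + ks ! i) (d i)"
    by metis
  show thesis
    using assms d by (intro that[of "map d [0..<length ks]"])
      (auto simp: list_all2_conv_all_nth intro!: nth_equalityI)
qed

lemma map_dec: "list_all2 (\<lambda>k d. wf_db K (p + k) d) ks ds \<Longrightarrow> map dec (map e ds) = ds"
  by (auto simp: list_all2_conv_all_nth intro!: nth_equalityI dec[of "p + ks ! i" for i])

lemma binding_model_T:
  assumes ar: "fun_arity L = fun_arity K"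
  shows "binding_model L T"
proof (intro binding_model.intro binding_model_axioms.intro)
  show "intensional_functional_structure T" by (rule intensional_functional_structure_T)
  have "wf_db K 0 (Free 0)" by simp
  then show "carr T 0 \<noteq> {}" unfolding T_simps by blast
next
  fix f p as assume "list_all2 (\<lambda>k a. a \<in> carr T (p + k)) (fun_arity L f) as"
  then obtain ds where ds: "as = map e ds" "list_all2 (\<lambda>k d. wf_db K (p + k) d) (fun_arity K f) ds"
    unfolding ar by (rule list_all2_carr_T)
  then have "wf_db K p (Op f (zip (fun_arity K f) ds))" if "f \<in> fun_syms K"
    using that by (auto simp: list_all2_iff)
  then show "fun_interp T f p as \<in> carr T p"
    using ds(1) map_dec[OF ds(2)] by auto
next
  fix f p as bs q
  assume as: "list_all2 (\<lambda>k a. a \<in> carr T (p + k)) (fun_arity L f) as" and bs: "bs \<in> tuples T q p"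
  from as obtain ds where ds: "as = map e ds" "list_all2 (\<lambda>k d. wf_db K (p + k) d) (fun_arity K f) ds"
    unfolding ar by (rule list_all2_carr_T)
  from bs obtain cs where cs: "bs = map e cs" "length cs = p" "\<And>i. i < p \<Longrightarrow> wf_db K q (cs ! i)"
    by (rule tuples_T) blast
  let ?ks = "fun_arity K f"
  show "box T q p (fun_interp T f p as) bs =
    fun_interp T f q (map2 (\<lambda>k a. box T (q + k) (p + k) a (lift T q k bs)) (fun_arity L f) as)"
  proof (cases "f \<in> fun_syms K")
    \<comment> \<open>The default value \<open>Free 0\<close> lies in every carrier and is fixed by
      every substitution, so a constant interpretation satisfies the equation.\<close>
    case False
    then show ?thesis using cs by (simp add: box_T[of p _ _ q])
  next
    case True
    have len: "length ?ks = length ds" using ds(2) by (rule list_all2_lengthD)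
    have wf: "wf_db K p (Op f (zip ?ks ds))"
      using ds(2) True by (auto simp: list_all2_iff)
    have "map2 (\<lambda>k a. box T (q + k) (p + k) a (lift T q k bs)) ?ks as =
        map e (map2 (\<lambda>k d. sb (up k ((!) cs)) d) ?ks ds)"
    proof (rule nth_equalityI)
      fix i assume "i < length (map2 (\<lambda>k a. box T (q + k) (p + k) a (lift T q k bs)) ?ks as)"
      then have i: "i < length ds" using len by (simp add: ds(1))
      then have "wf_db K (p + ?ks ! i) (ds ! i)" using ds(2) by (simp add: list_all2_conv_all_nth)
      then show "map2 (\<lambda>k a. box T (q + k) (p + k) a (lift T q k bs)) ?ks as ! i =
          map e (map2 (\<lambda>k d. sb (up k ((!) cs)) d) ?ks ds) ! i"
        using box_lift_T[of cs "?ks ! i" "ds ! i" q] cs i len by (simp add: ds(1))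
    qed (simp add: ds(1))
    \<comment> \<open>\<open>dec\<close> inverts \<open>e\<close> on well-formed terms only, so the
      substituted arguments must first be placed in their carriers.\<close>
    moreover have "map dec (map e (map2 (\<lambda>k d. sb (up k ((!) cs)) d) ?ks ds)) =
        map2 (\<lambda>k d. sb (up k ((!) cs)) d) ?ks ds"
    proof (rule map_dec[where ks = ?ks and p = q], unfold list_all2_conv_all_nth, intro conjI allI impI)
      fix i assume i: "i < length ?ks"
      then have "wf_db K (p + ?ks ! i) (ds ! i)" using ds(2) by (simp add: list_all2_conv_all_nth)
      then have "wf_db K (q + ?ks ! i) (sb (up (?ks ! i) ((!) cs)) (ds ! i))"
      proof (rule wf_db_sb)
        fix j assume "j < p + ?ks ! i"
        then show "wf_db K (q + ?ks ! i) (up (?ks ! i) ((!) cs) j)"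
          using cs(3)[of "j - ?ks ! i"] by (auto simp: up_def intro!: wf_db_ren[of K q])
      qed
      then show "wf_db K (q + ?ks ! i) (map2 (\<lambda>k d. sb (up k ((!) cs)) d) ?ks ds ! i)"
        using i len by simp
    qed (simp add: len)
    moreover have "sb ((!) cs) (Op f (zip ?ks ds)) =
        Op f (zip ?ks (map2 (\<lambda>k d. sb (up k ((!) cs)) d) ?ks ds))"
      using len by (auto intro!: nth_equalityI)
    moreover have "fun_interp T f p as = e (Op f (zip ?ks ds))"
      using True by (simp add: ds(1) map_dec[OF ds(2), simplified])
    ultimately show ?thesis
      using True cs by (simp add: ar box_T[OF wf _ cs(3)] del: map_map sb.simps)
  qed
qed

lemma den_T: "wf_tm K t \<Longrightarrow> den T xs (\<lambda>x. e (Free x)) t = e (db_of xs t)"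
proof (induction t arbitrary: xs rule: tm_induct)
  case (Var x)
  have "box T (length xs) 0 (e (Free x)) (map e []) = e (sb ((!) []) (Free x))"
    by (rule box_T[of 0]) auto
  then show ?case by (simp add: den_Var)
next
  case (Fn f args)
  have ar: "fun_arity K f = map (\<lambda>(ys, t). length ys) args" and f: "f \<in> fun_syms K"
    using Fn.prems by auto
  have "dec (den T (rev ys @ xs) (\<lambda>x. e (Free x)) t) = db_of (rev ys @ xs) t"
    if "(ys, t) \<in> set args" for ys t
  proof -
    have "wf_tm K t" using that Fn.prems by auto
    then show ?thesis using Fn.IH[OF that] dec[OF wf_db_of] by simp
  qed
  then have "zip (fun_arity K f) (map dec (map (\<lambda>(ys, t). den T (rev ys @ xs) (\<lambda>x. e (Free x)) t) args)) =
      map (\<lambda>(ys, t). (length ys, db_of (rev ys @ xs) t)) args"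
    unfolding ar by (auto simp: zip_map_map zip_same_conv_map)
  then show ?case using f by (simp del: map_map)
qed

end

section \<open>Completeness\<close>

text \<open>The truth lemma passes from a quantified proposition to its instances, which are not
  subformulas; this measure does not change under substitution.\<close>

fun depth :: "('f, 'p) fm \<Rightarrow> nat" where
  "depth (Atom P args) = 0"
| "depth Falsum = 0"
| "depth (Imp A B) = Suc (depth A + depth B)"
| "depth (Conj A B) = Suc (depth A + depth B)"
| "depth (Disj A B) = Suc (depth A + depth B)"
| "depth (Forall x A) = Suc (depth A)"
| "depth (Exists x A) = Suc (depth A)"

lemma depth_subst: "depth (subst t x A) = depth A"
proof -
  have "depth (subst_fm \<sigma> A) = depth A" for \<sigma>
    by (induction A arbitrary: \<sigma>) (simp_all add: Let_def)
  then show ?thesis by (simp add: subst_def)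
qed

text \<open>There is one sequent for each way in which membership in \<open>G\<close> could violate
  the truth table of a connective.\<close>

lemma basic_sequents:
  assumes "wf_fm L A" "wf_fm L B"
  shows "provable L {#Imp A B, A#} {#B#}" "provable L {#B#} {#Imp A B#}" "provable L {#} {#A, Imp A B#}"
    and "provable L {#Conj A B#} {#A#}" "provable L {#Conj A B#} {#B#}" "provable L {#A, B#} {#Conj A B#}"
    and "provable L {#Disj A B#} {#A, B#}" "provable L {#A#} {#Disj A B#}" "provable L {#B#} {#Disj A B#}"
proof -
  have *: "provable L \<Gamma> \<Delta>" if "C \<in># \<Gamma>" "C \<in># \<Delta>" "\<forall>D \<in># \<Gamma> + \<Delta>. wf_fm L D" for \<Gamma> \<Delta> C
    using that by (intro provable_mono[OF ax[of L C]]) auto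
  show "provable L {#Imp A B, A#} {#B#}"
    using assms by (intro imp_left *[of A] *[of B]) auto
  show "provable L {#B#} {#Imp A B#}"
    using assms by (intro imp_right *[of B]) auto
  have "provable L {#} {#Imp A B, A#}"
    using assms by (intro imp_right *[of A]) auto
  then show "provable L {#} {#A, Imp A B#}" by (simp add: add_mset_commute)
  show "provable L {#Conj A B#} {#A#}" "provable L {#Conj A B#} {#B#}"
    using assms by (auto intro!: conj_left intro: *[of A] *[of B])
  show "provable L {#A, B#} {#Conj A B#}"
    using assms by (intro conj_right *[of A] *[of B]) auto
  show "provable L {#Disj A B#} {#A, B#}"
    using assms by (intro disj_left *[of A] *[of B]) auto
  show "provable L {#A#} {#Disj A B#}" "provable L {#B#} {#Disj A B#}"
    using assms by (auto intro!: disj_right intro: *[of A] *[of B])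
qed

lemma quantifier_sequents:
  assumes "wf_fm L A" "wf_tm L t"
  shows "provable L {#Forall x A#} {#subst t x A#}" "provable L {#subst t x A#} {#Exists x A#}"
  using assms by (auto intro!: forall_left exists_right ax wf_subst)

section \<open>The truth lemma\<close>

context term_structure
begin

lemma Free_range: "range (\<lambda>x. e (Free x)) \<subseteq> carr T 0"
  by auto

lemma carr_T_named:
  assumes "a \<in> carr T 0"
  obtains t where "wf_tm K t" "den T [] (\<lambda>x. e (Free x)) t = a"
proof -
  obtain d where "wf_db K (length []) d" "a = e d" using assms by auto
  with db_of_surj[of K "[]" d] that show thesis by (auto simp: den_T)
qed

lemma truth:
  assumes model: "binding_model L T"
    and K: "\<And>t. wf_tm K t \<Longrightarrow> wf_tm L t" "\<And>A. wf_fm K A \<Longrightarrow> wf_fm L A"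
    and maximal: "G \<union> D = {A. wf_fm K A}" and consistent: "consistent L G D"
    and witness_G: "\<And>x B. Exists x B \<in> G \<Longrightarrow> \<exists>y. subst (Var y) x B \<in> G"
    and witness_D: "\<And>x B. Forall x B \<in> D \<Longrightarrow> \<exists>y. subst (Var y) x B \<in> D"
  shows "wf_fm K A \<Longrightarrow> sat T (\<lambda>x. e (Free x)) A \<longleftrightarrow> A \<in> G"
proof -
  interpret binding_model L T by (rule model)
  let ?\<phi> = "\<lambda>x. e (Free x)"
  have unprovable: "\<not> provable L \<Gamma> \<Delta>" if "set_mset \<Gamma> \<subseteq> G" "set_mset \<Delta> \<subseteq> D" for \<Gamma> \<Delta>
    using consistent that unfolding consistent_def by blast
  have D_iff: "A \<in> D \<longleftrightarrow> A \<notin> G" if "wf_fm K A" for A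
    using unprovable[of "{#A#}" "{#A#}"] ax[of L A] K(2)[OF that] maximal that by auto
  have quantifier: "sat T ?\<phi> (subst t x A) \<longleftrightarrow> sat T (?\<phi>(x := den T [] ?\<phi> t)) A"
    if "wf_fm K A" "wf_tm K t" for t x A
    using sat_subst[OF K(2)[OF that(1)] K(1)[OF that(2)] Free_range] .
  have closed: "den T [] ?\<phi> t \<in> carr T 0" if "wf_tm K t" for t
    using den_closed[OF Free_range K(1)[OF that], of "[]"] by simp
  show "wf_fm K A \<Longrightarrow> sat T ?\<phi> A \<longleftrightarrow> A \<in> G"
  proof (induction A rule: measure_induct_rule[where f = depth])
    case (less A)
    note wf = less.prems
    show ?case
    proof (cases A)
      case (Atom P args)
      have den: "map (\<lambda>(ys, t). den T (rev ys) ?\<phi> t) args = map (\<lambda>(ys, t). e (db_of (rev ys) t)) args"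
        using wf Atom by (auto simp: den_T)
      \<comment> \<open>The atom that makes the predicate true may differ from \<open>A\<close> in
        bound names. Equal de Bruijn forms make the two alpha-equivalent, and rule
        \<open>alpha\<close> carries membership in \<open>G\<close> over.\<close>
      have "A \<in> G" if args': "Atom P args' \<in> G"
        and eq: "map (\<lambda>(ys, t). e (db_of (rev ys) t)) args = map (\<lambda>(ys, t). e (db_of (rev ys) t)) args'"
        for args'
      proof -
        have wf': "wf_fm K (Atom P args')" using args' maximal by blast
        \<comment> \<open>The de Bruijn form of an argument does not record how many variables the
          predicate symbol binds in it, since some may not occur. The arity of \<open>P\<close>
          supplies these lengths.\<close>
        have "map (\<lambda>(ys, t). length ys) args' = map (\<lambda>(ys, t). length ys) args"
          using wf wf' Atom by simp
        then have len: "list_all2 (\<lambda>p q. length (fst p) = length (fst q)) args' args"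
          by (simp add: map_eq_map_iff_list_all2 case_prod_unfold)
        have "list_all2 (\<lambda>p q. e (db_of (rev (fst p)) (snd p)) = e (db_of (rev (fst q)) (snd q))) args' args"
          using eq[symmetric] by (simp add: map_eq_map_iff_list_all2 case_prod_unfold)
        then have "list_all2 (\<lambda>p q. length (fst p) = length (fst q) \<and>
            e (db_of (rev (fst p)) (snd p)) = e (db_of (rev (fst q)) (snd q))) args' args"
          using len by (simp add: list_all2_conv_all_nth)
        then have "alpha_eq (Atom P args') A"
          unfolding alpha_eq_def Atom alpha_fm.simps
        proof (intro conjI refl, elim list.rel_mono_strong, clarsimp)
          fix us s vs t
          assume "(us, s) \<in> set args'" "(vs, t) \<in> set args" and len: "length us = length vs"
            and eq: "e (db_of (rev us) s) = e (db_of (rev vs) t)"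
          then have "wf_tm K s" "wf_tm K t" using wf wf' Atom by auto
          then have "db_of (rev us) s = db_of (rev vs) t"
            using eq by (simp add: e_eq_iff[OF wf_db_of wf_db_of])
          then show "alpha_tm (rev us) (rev vs) s t"
            using len by (simp add: alpha_tm_of_db)
        qed
        then have "provable L {#Atom P args'#} {#A#}"
          using provable_alpha_right[OF ax[OF K(2)[OF wf']] _ K(2)[OF wf]] K(2)[OF wf']
          by (simp del: wf_fm.simps)
        then show ?thesis using unprovable[of "{#Atom P args'#}" "{#A#}"] args' D_iff[OF wf] by auto
      qed
      then show ?thesis unfolding Atom sat.simps den T_simps by blast
    next
      case Falsum
      have "provable L {#Falsum#} {#}" by (rule falsum_left) simp
      then show ?thesis using unprovable[of "{#Falsum#}" "{#}"] Falsum by auto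
    next
      case (Imp B C)
      then have wf': "wf_fm K B" "wf_fm K C" using wf by auto
      have "sat T ?\<phi> B \<longleftrightarrow> B \<in> G" "sat T ?\<phi> C \<longleftrightarrow> C \<in> G" using less wf' Imp by auto
      then show ?thesis
        using basic_sequents(1-3)[OF wf'[THEN K(2)]] D_iff[OF wf'(1)] D_iff[OF wf'(2)] D_iff[OF wf] Imp
          unprovable[of "{#A, B#}" "{#C#}"] unprovable[of "{#C#}" "{#A#}"] unprovable[of "{#}" "{#B, A#}"]
        by auto
    next
      case (Conj B C)
      then have wf': "wf_fm K B" "wf_fm K C" using wf by auto
      have "sat T ?\<phi> B \<longleftrightarrow> B \<in> G" "sat T ?\<phi> C \<longleftrightarrow> C \<in> G" using less wf' Conj by auto
      then show ?thesis
        using basic_sequents(4-6)[OF wf'[THEN K(2)]] D_iff[OF wf'(1)] D_iff[OF wf'(2)] D_iff[OF wf] Conj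
          unprovable[of "{#A#}" "{#B#}"] unprovable[of "{#A#}" "{#C#}"] unprovable[of "{#B, C#}" "{#A#}"]
        by auto
    next
      case (Disj B C)
      then have wf': "wf_fm K B" "wf_fm K C" using wf by auto
      have "sat T ?\<phi> B \<longleftrightarrow> B \<in> G" "sat T ?\<phi> C \<longleftrightarrow> C \<in> G" using less wf' Disj by auto
      then show ?thesis
        using basic_sequents(7-9)[OF wf'[THEN K(2)]] D_iff[OF wf'(1)] D_iff[OF wf'(2)] D_iff[OF wf] Disj
          unprovable[of "{#A#}" "{#B, C#}"] unprovable[of "{#B#}" "{#A#}"] unprovable[of "{#C#}" "{#A#}"]
        by auto
    next
      case (Forall x B)
      then have wfB: "wf_fm K B" using wf by simp
      have IH: "sat T (?\<phi>(x := den T [] ?\<phi> t)) B \<longleftrightarrow> subst t x B \<in> G" if "wf_tm K t" for t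
        using less.IH[of "subst t x B"] quantifier[OF wfB that, of x] wf_subst[OF wfB that]
        by (simp add: Forall depth_subst)
      show ?thesis
      proof
        assume "sat T ?\<phi> A"
        then have "subst (Var y) x B \<in> G" for y
          using IH[of "Var y"] closed[of "Var y"] by (auto simp: Forall simp del: T_simps(1))
        moreover have "wf_fm K (subst (Var y) x B)" for y by (rule wf_subst[OF wfB]) simp
        \<comment> \<open>Otherwise \<open>A\<close> lies in \<open>D\<close>, and its witness would
          be an instance in \<open>D\<close>, hence outside \<open>G\<close>.\<close>
        ultimately show "A \<in> G" using witness_D[of x B] D_iff[OF wf] D_iff unfolding Forall by blast
      next
        assume A: "A \<in> G"
        have "sat T (?\<phi>(x := a)) B" if a: "a \<in> carr T 0" for a
        proof -
          from a obtain t where t: "wf_tm K t" "den T [] ?\<phi> t = a" by (rule carr_T_named)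
          have "subst t x B \<in> G"
            using unprovable[of "{#A#}" "{#subst t x B#}"] quantifier_sequents(1)[OF K(2)[OF wfB] K(1)[OF t(1)], of x]
              A D_iff[OF wf_subst[OF wfB t(1)], of x] by (auto simp: Forall)
          then show ?thesis using IH[OF t(1)] t(2) by simp
        qed
        then show "sat T ?\<phi> A" by (simp add: Forall del: T_simps(1))
      qed
    next
      case (Exists x B)
      then have wfB: "wf_fm K B" using wf by simp
      have IH: "sat T (?\<phi>(x := den T [] ?\<phi> t)) B \<longleftrightarrow> subst t x B \<in> G" if "wf_tm K t" for t
        using less.IH[of "subst t x B"] quantifier[OF wfB that, of x] wf_subst[OF wfB that]
        by (simp add: Exists depth_subst)
      show ?thesis
      proof
        assume "sat T ?\<phi> A"
        then obtain a where a: "a \<in> carr T 0" "sat T (?\<phi>(x := a)) B"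
          by (auto simp: Exists simp del: T_simps(1))
        from a(1) obtain t where t: "wf_tm K t" "den T [] ?\<phi> t = a" by (rule carr_T_named)
        then have "subst t x B \<in> G" using IH[OF t(1)] a(2) by simp
        then show "A \<in> G"
          using unprovable[of "{#subst t x B#}" "{#A#}"] quantifier_sequents(2)[OF K(2)[OF wfB] K(1)[OF t(1)], of x]
            D_iff[OF wf] by (auto simp: Exists)
      next
        assume "A \<in> G"
        then obtain y where "subst (Var y) x B \<in> G" using witness_G Exists by blast
        then show "sat T ?\<phi> A"
          using IH[of "Var y"] closed[of "Var y"] by (auto simp: Exists simp del: T_simps(1))
      qed
    qed
  qed
qed

end

theorem completeness:
  fixes L :: "('f, 'p) language"
    and \<Gamma> \<Delta> :: "('f, 'p) fm multiset"
  assumes "infinite (UNIV :: 'u set)"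
    and wf: "\<And>A. A \<in># \<Gamma> + \<Delta> \<Longrightarrow> wf_fm L A"
    and np: "\<not> provable L \<Gamma> \<Delta>"
  obtains M :: "('f, 'p, 'u) binding_structure" and \<phi> where "binding_model L M"
    "range \<phi> \<subseteq> carr M 0" "\<forall>A \<in># \<Gamma>. sat M \<phi> A" "\<forall>B \<in># \<Delta>. \<not> sat M \<phi> B"
proof -
  define F where "F = (\<Union>A \<in> set_mset (\<Gamma> + \<Delta>). set1_fm A)"
  define P where "P = (\<Union>A \<in> set_mset (\<Gamma> + \<Delta>). set2_fm A)"
  define K where "K = restrict_language L F P"
  \<comment> \<open>The cardinal bound of the datatype is \<open>natLeq\<close>; lying strictly
    below it means being finite.\<close>
  have "finite (set1_fm A)" "finite (set2_fm A)" for A :: "('f, 'p) fm"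
    using fm.set_bd by (simp_all add: finite_iff_ordLess_natLeq)
  then have countable: "countable F" "countable P"
    by (simp_all add: F_def P_def countable_finite)
  have K: "wf_tm K t \<Longrightarrow> wf_tm L t" "wf_fm K A \<Longrightarrow> wf_fm L A" for t A
    by (simp_all add: K_def wf_tm_restrict wf_fm_restrict)
  have sub: "set_mset (\<Gamma> + \<Delta>) \<subseteq> {A. wf_fm K A}"
    using wf by (auto simp: K_def wf_fm_restrict F_def P_def)
  have fms: "countable {A. wf_fm K A}"
    by (rule countable_subset[OF _ countable_fm[OF countable]]) (auto simp: K_def wf_fm_restrict)
  obtain G D where GD: "set_mset \<Gamma> \<subseteq> G" "set_mset \<Delta> \<subseteq> D" "G \<union> D = {A. wf_fm K A}" "consistent L G D"
    "\<And>x B. Exists x B \<in> G \<Longrightarrow> \<exists>y. subst (Var y) x B \<in> G"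
    "\<And>x B. Forall x B \<in> D \<Longrightarrow> \<exists>y. subst (Var y) x B \<in> D"
    using np sub _ _ fms by (rule henkin_extension) (auto intro: K wf_subst)
  have "countable (fun_syms K)" by (simp add: K_def countable)
  from countable_db[OF this] obtain e :: "'f db \<Rightarrow> 'u" where "inj_on e {d. \<exists>n. wf_db K n d}"
    using countable_embedding[OF assms(1)] by blast
  then interpret term_structure K G e by unfold_locales
  have model: "binding_model L T" by (rule binding_model_T) (simp add: K_def)
  have sat_iff: "sat T (\<lambda>x. e (Free x)) A \<longleftrightarrow> A \<in> G" if "wf_fm K A" for A
    using model K GD(3-6) that by (rule truth)
  show thesis
  proof (rule that[OF model Free_range])
    show "\<forall>A \<in># \<Gamma>. sat T (\<lambda>x. e (Free x)) A" using sat_iff sub GD(1) by auto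
    show "\<forall>B \<in># \<Delta>. \<not> sat T (\<lambda>x. e (Free x)) B"
    proof
      fix B assume B: "B \<in># \<Delta>"
      then have "wf_fm K B" using sub by auto
      moreover have "B \<notin> G"
        using GD(2,4) B ax[OF K(2)[OF \<open>wf_fm K B\<close>]] unfolding consistent_def
        by (metis empty_subsetI insert_subset set_mset_add_mset_insert set_mset_empty subsetD)
      ultimately show "\<not> sat T (\<lambda>x. e (Free x)) B" using sat_iff by blast
    qed
  qed
qed

theorem theorem2:
  fixes L :: "('f, 'p) language"
    and \<Gamma> \<Delta> :: "('f, 'p) fm multiset"
  assumes infinite_universe: "infinite (UNIV :: 'u set)"
    and propositions: "\<And>A. A \<in># \<Gamma> + \<Delta> \<Longrightarrow> wf_fm L A"
    and closed: "\<And>A. A \<in># \<Gamma> + \<Delta> \<Longrightarrow> fv_fm A = {}"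
  shows "provable L \<Gamma> \<Delta> \<longleftrightarrow>
    (\<forall>M :: ('f, 'p, 'u) binding_structure.
       binding_model L M \<longrightarrow> (\<forall>A \<in># \<Gamma>. valid M A) \<longrightarrow> (\<exists>B \<in># \<Delta>. valid M B))"
proof
  assume prov: "provable L \<Gamma> \<Delta>"
  show "\<forall>M :: ('f, 'p, 'u) binding_structure.
       binding_model L M \<longrightarrow> (\<forall>A \<in># \<Gamma>. valid M A) \<longrightarrow> (\<exists>B \<in># \<Delta>. valid M B)"
  proof (intro allI impI)
    fix M :: "('f, 'p, 'u) binding_structure"
    assume M: "binding_model L M" and \<Gamma>: "\<forall>A \<in># \<Gamma>. valid M A"
    \<comment> \<open>Closed propositions may be evaluated under any assignment; a constant one
      exists because \<open>M_0\<close> is non-empty.\<close>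
    obtain a where "a \<in> carr M 0" using binding_model.carr_nonempty[OF M] by blast
    then have \<phi>: "range (\<lambda>_. a) \<subseteq> carr M 0" by auto
    then have "\<forall>A \<in># \<Gamma>. sat M (\<lambda>_. a) A" using \<Gamma> valid_closed[OF _ \<phi>] closed by auto
    from binding_model.soundness[OF M prov \<phi> this]
    show "\<exists>B \<in># \<Delta>. valid M B" using valid_closed[OF _ \<phi>] closed by auto
  qed
next
  assume entails: "\<forall>M :: ('f, 'p, 'u) binding_structure.
       binding_model L M \<longrightarrow> (\<forall>A \<in># \<Gamma>. valid M A) \<longrightarrow> (\<exists>B \<in># \<Delta>. valid M B)"
  show "provable L \<Gamma> \<Delta>"
  proof (rule ccontr)
    assume "\<not> provable L \<Gamma> \<Delta>"
    with infinite_universe propositions obtain M :: "('f, 'p, 'u) binding_structure" and \<phi> where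
      M: "binding_model L M" "range \<phi> \<subseteq> carr M 0" "\<forall>A \<in># \<Gamma>. sat M \<phi> A" "\<forall>B \<in># \<Delta>. \<not> sat M \<phi> B"
      by (rule completeness)
    have "\<forall>A \<in># \<Gamma>. valid M A" using M(3) valid_closed[OF _ M(2)] closed by auto
    moreover have "\<forall>B \<in># \<Delta>. \<not> valid M B" using M(4) valid_closed[OF _ M(2)] closed by auto
    ultimately show False using entails M(1) by blast
  qed
qed

end
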